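(* Consider, for each $K$ (with $K\to\infty$), an integer $s=s_K$ with $0<s=o(K)$, a deterministic design matrix $X=X_K\in\mathbb{R}^{n\times K}$ (with $n=n_K$ allowed to depend on $K$), and the model $Y=X\beta+\varepsilon$, $\varepsilon\sim N(0,I_n)$, with $\beta\in\Theta^{K-1}$. Let $\alpha_1,\alpha_2>0$ be constants with $\alpha_1/2+\alpha_2\ge 1$, and put on $\beta$ the double spike Dirichlet prior $g(\cdot\,;\theta,\rho_1,\rho_2)$ with $\rho_1=K^{\alpha_1}$, $\rho_2=K^{-\alpha_2}$, and $\theta=\theta_K$ satisfying $c/K\le\theta\le s/K$ for some constant $c>0$ not depending on $K$. Suppose the compatibility condition $\Phi(s)>0$ holds. Then, for all sufficiently large constants $M>0$, $$\sup_{\beta^*\in\Theta(s,K)}E_{\beta^*}\,\Pi\left(\|\beta-\beta^*\|_1>\frac{M}{\Phi(s)}\,\frac{s\log K}{\min\left(\|X\|,\sqrt{K^{\alpha_1}}\right)}\,\Big|\,Y\right)\longrightarrow 0\qquad\text{as }K\to\infty.$$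
   Context: Probability simplex: $\Theta^{K-1}=\{\beta\in\mathbb{R}^K:\sum_{i=1}^K\beta_i=1,\ \beta_i\ge 0\text{ for all }1\le i\le K\}$. Structured simplex vectors: $\Theta(s,K)$ is the set of $\beta\in\Theta^{K-1}$ having exactly $s\ge1$ nonzero elements, all of which equal the common value $1/s$. Double spike Dirichlet prior with parameters $\theta\in(0,1)$ and $\rho_1>\rho_2>0$: draw $\gamma_1,\dots,\gamma_K$ independently from $\text{Bernoulli}(\theta)$ and, given $\gamma=(\gamma_1,\dots,\gamma_K)$, draw $\beta$ from the Dirichlet distribution on $\Theta^{K-1}$ whose $i$-th concentration parameter is $\rho_1\gamma_i+\rho_2(1-\gamma_i)$. With $|\gamma|=\sum_i\gamma_i$, its marginal density on the simplex is $$g(\beta;\theta,\rho_1,\rho_2)=\sum_{\gamma\in\{0,1\}^K}\frac{\Gamma(\rho_1|\gamma|+\rho_2(K-|\gamma|))}{\Gamma(\rho_1)^{|\gamma|}\Gamma(\rho_2)^{K-|\gamma|}}\prod_{i=1}^K\beta_i^{\rho_1\gamma_i+\rho_2(1-\gamma_i)-1}\,\theta^{|\gamma|}(1-\theta)^{K-|\gamma|}.$$ Posterior: $\Pi(\cdot\mid Y)$ is the posterior distribution of $\beta$ given $Y$, i.e. for measurable $B\subset\Theta^{K-1}$, $\Pi(B\mid Y)=\int_B p_\beta(Y)g(\beta;\theta,\rho_1,\rho_2)\,d\beta\big/\int_{\Theta^{K-1}}p_\beta(Y)g(\beta;\theta,\rho_1,\rho_2)\,d\beta$, where $p_\beta$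 is the density of $N(X\beta,I_n)$. $E_{\beta^*}$ denotes expectation under $Y\sim N(X\beta^*,I_n)$. Norms: $\|\beta\|_q=(\sum_j|\beta_j|^q)^{1/q}$ for vectors, and $\|X\|=\max_j\|X_{\cdot,j}\|_2$ is the maximal Euclidean norm of the columns of $X$. Compatibility number: $$\Phi(s)=\inf\left\{\frac{\|X\beta\|_2\sqrt{s}}{\|X\|\,\|\beta\|_1}:\ \|\beta\|_1\le 2\right\},$$ where the infimum is over vectors $\beta\in\mathbb{R}^K$, $\beta\neq0$, with $\|\beta\|_1\le 2$. The compatibility condition is $\Phi(s)>0$. *)

theory Defs
  imports "HOL-Probability.Probability" "HOL-Library.Landau_Symbols"
begin

text \<open>Since the dimensions grow along the sequences considered, they cannot be types: a vector
  in \<open>\<real>\<^sup>K\<close> is an element of \<open>{..<K} \<rightarrow>\<^sub>E UNIV\<close>, and an \<open>n \<times> K\<close> matrix is a function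
  \<open>X :: nat \<Rightarrow> nat \<Rightarrow> real\<close> of which only the entries \<open>X i j\<close> with \<open>i < n\<close> and \<open>j < K\<close> are used.\<close>

definition mat_vec :: "nat \<Rightarrow> (nat \<Rightarrow> nat \<Rightarrow> real) \<Rightarrow> (nat \<Rightarrow> real) \<Rightarrow> nat \<Rightarrow> real" where
  "mat_vec K X \<beta> i = (\<Sum>j<K. X i j * \<beta> j)"

definition l1_norm :: "nat \<Rightarrow> (nat \<Rightarrow> real) \<Rightarrow> real" where
  "l1_norm K \<beta> = (\<Sum>j<K. \<bar>\<beta> j\<bar>)"

definition max_col_norm :: "nat \<Rightarrow> nat \<Rightarrow> (nat \<Rightarrow> nat \<Rightarrow> real) \<Rightarrow> real" where
  "max_col_norm n K X = (MAX j\<in>{..<K}. L2_set (\<lambda>i. X i j) {..<n})"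

text \<open>The quotient is \<open>0\<close> if \<open>X = 0\<close>, so a positive compatibility number entails \<open>X \<noteq> 0\<close>
  (for \<open>K > 0\<close>).\<close>

definition compat_number :: "nat \<Rightarrow> nat \<Rightarrow> (nat \<Rightarrow> nat \<Rightarrow> real) \<Rightarrow> nat \<Rightarrow> real" where
  "compat_number n K X s =
     Inf {L2_set (mat_vec K X \<beta>) {..<n} * sqrt (real s) / (max_col_norm n K X * l1_norm K \<beta>) | \<beta>.
            \<beta> \<in> {..<K} \<rightarrow>\<^sub>E UNIV \<and> (\<exists>j<K. \<beta> j \<noteq> 0) \<and> l1_norm K \<beta> \<le> 2}"

definition prob_simplex :: "nat \<Rightarrow> (nat \<Rightarrow> real) set" where
  "prob_simplex K = {\<beta> \<in> {..<K} \<rightarrow>\<^sub>E UNIV. (\<Sum>i<K. \<beta> i) = 1 \<and> (\<forall>i<K. 0 \<le> \<beta> i)}"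

definition structured_simplex :: "nat \<Rightarrow> nat \<Rightarrow> (nat \<Rightarrow> real) set" where
  "structured_simplex s K =
     {\<beta> \<in> prob_simplex K. card {i. i < K \<and> \<beta> i \<noteq> 0} = s \<and>
        (\<forall>i<K. \<beta> i \<noteq> 0 \<longrightarrow> \<beta> i = 1 / real s)}"

text \<open>The reference measure \<open>d\<beta>\<close> of Dirichlet densities: Lebesgue measure in the first \<open>K - 1\<close>
  coordinates, transported to the affine hyperplane of vectors whose coordinates sum to \<open>1\<close>.\<close>

definition simplex_chart :: "nat \<Rightarrow> (nat \<Rightarrow> real) \<Rightarrow> nat \<Rightarrow> real" where
  "simplex_chart K x = (\<lambda>i\<in>{..<K}. if i < K - 1 then x i else 1 - (\<Sum>j<K - 1. x j))"

definition simplex_lborel :: "nat \<Rightarrow> (nat \<Rightarrow> real) measure" where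
  "simplex_lborel K =
     distr (PiM {..<K - 1} (\<lambda>_. lborel)) (PiM {..<K} (\<lambda>_. lborel)) (simplex_chart K)"

lemma simplex_chart_measurable [measurable]:
  "simplex_chart K \<in> PiM {..<K - 1} (\<lambda>_. lborel) \<rightarrow>\<^sub>M PiM {..<K} (\<lambda>_. lborel)"
  unfolding simplex_chart_def
proof (rule measurable_restrict)
  fix i assume "i \<in> {..<K}"
  show "(\<lambda>x. if i < K - 1 then x i else 1 - (\<Sum>j<K - 1. x j)) \<in> PiM {..<K - 1} (\<lambda>_. lborel) \<rightarrow>\<^sub>M lborel"
    by (cases "i < K - 1") (simp_all, measurable)
qed

lemma sum_simplex_chart:
  assumes "K > 0"
  shows "(\<Sum>i<K. simplex_chart K x i) = 1"
proof -
  obtain k where "K = Suc k" using assms by (cases K) auto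
  then show ?thesis by (simp add: simplex_chart_def)
qed

lemma prob_simplex_measurable [measurable]: "prob_simplex K \<in> sets (simplex_lborel K)"
proof -
  have "{\<beta> \<in> space (PiM {..<K} (\<lambda>_. lborel)). (\<Sum>i<K. \<beta> i) = 1 \<and> (\<forall>i\<in>{..<K}. 0 \<le> (\<beta> i :: real))}
          \<in> sets (PiM {..<K} (\<lambda>_. lborel))"
    by measurable
  also have "{\<beta> \<in> space (PiM {..<K} (\<lambda>_. lborel)). (\<Sum>i<K. \<beta> i) = 1 \<and> (\<forall>i\<in>{..<K}. 0 \<le> (\<beta> i :: real))}
      = prob_simplex K"
    by (auto simp: prob_simplex_def space_PiM)
  finally show ?thesis by (simp add: simplex_lborel_def)
qed

text \<open>On the boundary of the simplex the convention \<open>0 powr a = 0\<close> applies; the boundary is a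
  null set for the reference measure when \<open>K > 1\<close>, and empty when \<open>K = 1\<close>.\<close>

definition double_spike_dirichlet_density ::
    "nat \<Rightarrow> real \<Rightarrow> real \<Rightarrow> real \<Rightarrow> (nat \<Rightarrow> real) \<Rightarrow> real" where
  "double_spike_dirichlet_density K \<theta> \<rho>1 \<rho>2 \<beta> =
     (\<Sum>\<gamma> \<in> {..<K} \<rightarrow>\<^sub>E {0, 1 :: nat}. let m = (\<Sum>i<K. \<gamma> i) in
        Gamma (\<rho>1 * real m + \<rho>2 * real (K - m)) / (Gamma \<rho>1 ^ m * Gamma \<rho>2 ^ (K - m))
        * (\<Prod>i<K. \<beta> i powr (\<rho>1 * real (\<gamma> i) + \<rho>2 * (1 - real (\<gamma> i)) - 1))
        * \<theta> ^ m * (1 - \<theta>) ^ (K - m))"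

definition std_gaussian_density :: "nat \<Rightarrow> (nat \<Rightarrow> real) \<Rightarrow> (nat \<Rightarrow> real) \<Rightarrow> real" where
  "std_gaussian_density n \<mu> y = (\<Prod>i<n. normal_density (\<mu> i) 1 (y i))"

text \<open>The distribution \<open>N(\<mu>, I\<^sub>n)\<close>.\<close>

definition std_gaussian :: "nat \<Rightarrow> (nat \<Rightarrow> real) \<Rightarrow> (nat \<Rightarrow> real) measure" where
  "std_gaussian n \<mu> =
     density (PiM {..<n} (\<lambda>_. lborel)) (\<lambda>y. ennreal (std_gaussian_density n \<mu> y))"

definition posterior ::
    "nat \<Rightarrow> nat \<Rightarrow> (nat \<Rightarrow> nat \<Rightarrow> real) \<Rightarrow> real \<Rightarrow> real \<Rightarrow> real \<Rightarrow> (nat \<Rightarrow> real) \<Rightarrow> (nat \<Rightarrow> real) set \<Rightarrow> ennreal"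
  where
  "posterior n K X \<theta> \<rho>1 \<rho>2 Y B =
     (\<integral>\<^sup>+\<beta>\<in>B. ennreal (std_gaussian_density n (mat_vec K X \<beta>) Y
                   * double_spike_dirichlet_density K \<theta> \<rho>1 \<rho>2 \<beta>) \<partial>simplex_lborel K)
     / (\<integral>\<^sup>+\<beta>\<in>prob_simplex K. ennreal (std_gaussian_density n (mat_vec K X \<beta>) Y
                   * double_spike_dirichlet_density K \<theta> \<rho>1 \<rho>2 \<beta>) \<partial>simplex_lborel K)"

end

theory Submission
  imports Defs
begin

text \<open>The \<open>\<ell>\<^sup>1\<close>-distance of a simplex vector from \<open>\<beta>\<^sup>*\<close> is twice the largest sum
  \<open>\<Sum>\<^sub>i\<^sub>\<in>\<^sub>T (\<beta>\<^sup>*\<^sub>i - \<beta>\<^sub>i)\<close> over subsets \<open>T\<close> of the support of \<open>\<beta>\<^sup>*\<close>. Hence the complement of an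
  \<open>\<ell>\<^sup>1\<close>-ball is a union of \<open>2\<^sup>s\<close> convex sets, each of which can be tested against \<open>\<beta>\<^sup>*\<close> by a single
  linear statistic: by compatibility its image under \<open>X\<close> has distance at least
  \<open>M s\<^sup>1\<^sup>/\<^sup>2 W log K\<close> from \<open>X \<beta>\<^sup>*\<close>, where \<open>W = max 1 (\<parallel>X\<parallel> / \<rho>\<^sub>1\<^sup>1\<^sup>/\<^sup>2)\<close>, so the errors are
  \<open>exp (- C M\<^sup>2 s W\<^sup>2 (log K)\<^sup>2)\<close>. No sparsity or concentration of the prior is needed here. On the
  other side, the mixture component whose spike indicators match the support of \<open>\<beta>\<^sup>*\<close> has prior
  weight at least \<open>exp (- 2 s log K)\<close> and puts half of its mass within \<open>5 / \<rho>\<^sub>1\<^sup>1\<^sup>/\<^sup>2\<close> of \<open>\<beta>\<^sup>*\<close>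
  (this uses \<open>K \<rho>\<^sub>2 \<le> \<rho>\<^sub>1\<^sup>1\<^sup>/\<^sup>2\<close>, that is \<open>\<alpha>\<^sub>1 / 2 + \<alpha>\<^sub>2 \<ge> 1\<close>), which bounds the evidence from below by
  \<open>exp (- 25 s W\<^sup>2 log K)\<close> relative to the likelihood at \<open>\<beta>\<^sup>*\<close>.\<close>

subsection \<open>The Dirichlet integral\<close>

interpretation lborel_prod: product_sigma_finite "\<lambda>_::nat. lborel :: real measure"
  by standard

lemma nn_integral_Beta_scaled:
  fixes a b c :: real
  assumes a: "a > 0" and b: "b > 0"
  shows "(\<integral>\<^sup>+t. ennreal (indicator {0..c} t * (t powr (a - 1) * (c - t) powr (b - 1))) \<partial>lborel)
           = ennreal (indicator {0..} c * (Beta a b * c powr (a + b - 1)))"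
proof (cases "c > 0")
  case True
  have ind: "indicator {0..c} (c * x) = (indicator {0..1} x :: real)" for x
    using True by (auto simp: indicator_def zero_le_mult_iff)
  have "((\<lambda>t. if t \<in> {0..1} then t powr (a - 1) * (1 - t) powr (b - 1) else 0)
          has_integral Beta a b) UNIV"
    using has_integral_Beta_real[OF a b] by (simp only: has_integral_restrict_UNIV)
  also have "(\<lambda>t. if t \<in> {0..1} then t powr (a - 1) * (1 - t) powr (b - 1) else 0)
      = (\<lambda>t. indicator {0..1} t * (t powr (a - 1) * (1 - t) powr (b - 1)))"
    by (auto simp: fun_eq_iff)
  finally have unit: "(\<integral>\<^sup>+t. ennreal (indicator {0..1} t * (t powr (a - 1) * (1 - t) powr (b - 1))) \<partial>lborel)
      = ennreal (Beta a b)"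
    by (intro nn_integral_has_integral_lborel) (auto intro!: mult_nonneg_nonneg)
  have pt: "indicator {0..c} (c * x) * ((c * x) powr (a - 1) * (c - c * x) powr (b - 1))
      = c powr (a + b - 2) * (indicator {0..1} x * (x powr (a - 1) * (1 - x) powr (b - 1)))" for x
  proof (cases "x \<in> {0..1}")
    case inx: True
    have "c - c * x = c * (1 - x)" by (simp add: algebra_simps)
    then have "(c * x) powr (a - 1) * (c - c * x) powr (b - 1)
        = (c powr (a - 1) * c powr (b - 1)) * (x powr (a - 1) * (1 - x) powr (b - 1))"
      using inx True by (simp add: powr_mult)
    also have "c powr (a - 1) * c powr (b - 1) = c powr (a + b - 2)"
      by (simp add: powr_add[symmetric] algebra_simps)
    finally show ?thesis using inx by (simp add: ind)
  qed (simp add: ind)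
  have "(\<integral>\<^sup>+t. ennreal (indicator {0..c} t * (t powr (a - 1) * (c - t) powr (b - 1))) \<partial>lborel)
      = ennreal c * (\<integral>\<^sup>+x. ennreal (c powr (a + b - 2))
          * ennreal (indicator {0..1} x * (x powr (a - 1) * (1 - x) powr (b - 1))) \<partial>lborel)"
    using True
    by (subst nn_integral_real_affine[where c = c and t = 0])
       (auto simp: pt ennreal_mult' simp del: ennreal_mult'' intro!: arg_cong2[where f = "(*)"] nn_integral_cong)
  also have "\<dots> = ennreal c * (ennreal (c powr (a + b - 2)) * ennreal (Beta a b))"
    unfolding unit[symmetric] by (intro arg_cong2[where f = "(*)"] refl nn_integral_cmult) measurable
  also have "\<dots> = ennreal (c * (c powr (a + b - 2) * Beta a b))"
    using True by (simp add: ennreal_mult')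
  also have "c * (c powr (a + b - 2) * Beta a b) = Beta a b * c powr (a + b - 1)"
  proof -
    have "c * c powr (a + b - 2) = c powr 1 * c powr (a + b - 2)" using True by simp
    also have "\<dots> = c powr (a + b - 1)" by (subst powr_add[symmetric]) simp
    finally show ?thesis by simp
  qed
  finally show ?thesis using True by simp
next
  \<comment> \<open>For negative \<open>c\<close> the interval is empty. For \<open>c = 0\<close>
    both sides vanish because \<open>0 powr a = 0\<close>.\<close>
  case False
  have "(\<integral>\<^sup>+t. ennreal (indicator {0..c} t * (t powr (a - 1) * (c - t) powr (b - 1))) \<partial>lborel) = (\<integral>\<^sup>+t. 0 \<partial>(lborel :: real measure))"
    using False by (intro nn_integral_cong) (auto simp: indicator_def)
  then show ?thesis using False by (cases "c = 0") auto
qed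

text \<open>Integrate out the last coordinate \<open>y\<close>: the other coordinates see the same
  integral at level \<open>c - y\<close>, so \<open>c\<close> must be arbitrary in the induction.
  What remains is a scaled Beta integral in \<open>y\<close>, whose Gamma factors telescope with
  those of the induction hypothesis.\<close>

lemma nn_integral_corner_simplex:
  fixes a :: "nat \<Rightarrow> real"
  assumes "\<And>i. i < k \<Longrightarrow> a i > 0" and "b > 0"
  shows "(\<integral>\<^sup>+x. ennreal (if (\<forall>i\<in>{..<k}. 0 \<le> x i) \<and> (\<Sum>i<k. x i) \<le> c
            then (\<Prod>i<k. x i powr (a i - 1)) * (c - (\<Sum>i<k. x i)) powr (b - 1) else 0)
            \<partial>PiM {..<k} (\<lambda>_. lborel))
         = ennreal (indicator {0..} c * ((\<Prod>i<k. Gamma (a i)) * Gamma b / Gamma ((\<Sum>i<k. a i) + b)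
             * c powr ((\<Sum>i<k. a i) + b - 1)))"
  using assms(1)
proof (induction k arbitrary: c)
  case 0
  have "Gamma b \<noteq> 0" using \<open>b > 0\<close> by (metis Gamma_real_pos less_irrefl)
  then show ?case by (simp add: product_sigma_finite.nn_integral_empty lborel_prod.nn_integral_empty)
next
  case (Suc k)
  define B where "B = (\<Sum>i<k. a i) + b"
  define C where "C = (\<Prod>i<k. Gamma (a i)) * Gamma b / Gamma B"
  have pos: "a i > 0" if "i < k" for i using Suc.prems that by simp
  have ak: "a k > 0" using Suc.prems by simp
  have B: "B > 0" unfolding B_def using pos \<open>b > 0\<close> by (intro add_nonneg_pos sum_nonneg) (auto intro: less_imp_le)
  have GB: "Gamma B > 0" using B by simp
  have C: "C \<ge> 0" unfolding C_def using pos \<open>b > 0\<close> B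
    by (intro divide_nonneg_nonneg mult_nonneg_nonneg prod_nonneg) (auto intro!: less_imp_le Gamma_real_pos)
  let ?g = "\<lambda>c x. ennreal (if (\<forall>i\<in>{..<k}. 0 \<le> x i) \<and> (\<Sum>i<k. x i) \<le> c
            then (\<Prod>i<k. x i powr (a i - 1)) * (c - (\<Sum>i<k. x i)) powr (b - 1) else 0)"
  let ?f = "\<lambda>x. ennreal (if (\<forall>i\<in>{..<Suc k}. 0 \<le> x i) \<and> (\<Sum>i<Suc k. x i) \<le> c
            then (\<Prod>i<Suc k. x i powr (a i - 1)) * (c - (\<Sum>i<Suc k. x i)) powr (b - 1) else 0)"
  have split: "?f (x(k := y)) = ennreal (indicator {0..} y * y powr (a k - 1)) * ?g (c - y) x" for x y
  proof -
    have "(\<Prod>i<k. (x(k := y)) i powr (a i - 1)) = (\<Prod>i<k. x i powr (a i - 1))"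
      "(\<Sum>i<k. (x(k := y)) i) = (\<Sum>i<k. x i)" by (auto intro!: prod.cong sum.cong)
    moreover have "(\<forall>i\<in>{..<Suc k}. 0 \<le> (x(k := y)) i) \<longleftrightarrow> (\<forall>i\<in>{..<k}. 0 \<le> x i) \<and> 0 \<le> y"
      by (auto simp: less_Suc_eq)
    moreover have "(\<Sum>i<k. x i) + y \<le> c \<longleftrightarrow> (\<Sum>i<k. x i) \<le> c - y" by linarith
    ultimately show ?thesis
      by (simp add: ennreal_mult'[symmetric] indicator_def mult_ac fun_upd_same
          diff_diff_eq add.commute[of y] del: fun_upd_apply)
  qed
  have "(\<integral>\<^sup>+x. ?f x \<partial>PiM {..<Suc k} (\<lambda>_. lborel))
      = (\<integral>\<^sup>+y. (\<integral>\<^sup>+x. ?f (x(k := y)) \<partial>PiM {..<k} (\<lambda>_. lborel)) \<partial>lborel)"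
    unfolding lessThan_Suc[of k]
    by (rule lborel_prod.product_nn_integral_insert_rev) (simp_all add: lessThan_Suc[symmetric])
  also have "\<dots> = (\<integral>\<^sup>+y. ennreal (indicator {0..} y * y powr (a k - 1)) *
       (\<integral>\<^sup>+x. ?g (c - y) x \<partial>PiM {..<k} (\<lambda>_. lborel)) \<partial>lborel)"
    by (simp only: split) (intro nn_integral_cong nn_integral_cmult; measurable)
  also have "\<dots> = (\<integral>\<^sup>+y. ennreal (indicator {0..} y * y powr (a k - 1)) *
       ennreal (indicator {0..} (c - y) * (C * (c - y) powr (B - 1))) \<partial>lborel)"
    by (subst Suc.IH) (use pos in \<open>auto simp: B_def C_def\<close>)
  also have "\<dots> = (\<integral>\<^sup>+y. ennreal C * ennreal (indicator {0..c} y * (y powr (a k - 1) * (c - y) powr (B - 1))) \<partial>lborel)"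
    using C by (intro nn_integral_cong) (auto simp: ennreal_mult'[symmetric] indicator_def mult_ac)
  also have "\<dots> = ennreal C * ennreal (indicator {0..} c * (Beta (a k) B * c powr (a k + B - 1)))"
    by (subst nn_integral_cmult) (simp_all add: nn_integral_Beta_scaled[OF ak B])
  also have "\<dots> = ennreal (indicator {0..} c * (C * Beta (a k) B * c powr (a k + B - 1)))"
    using C by (simp add: ennreal_mult'[symmetric] mult_ac)
  also have "C * Beta (a k) B = (\<Prod>i<Suc k. Gamma (a i)) * Gamma b / Gamma ((\<Sum>i<Suc k. a i) + b)"
    using GB by (simp add: C_def Beta_def B_def add_ac)
  also have "a k + B = (\<Sum>i<Suc k. a i) + b" by (simp add: B_def)
  finally show ?case .
qed

text \<open>In the chart the last coordinate is one minus the sum of the others. The integral is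
  therefore the corner integral at level 1, with the last parameter in the role of
  \<open>b\<close>.\<close>

lemma nn_integral_Dirichlet:
  fixes a :: "nat \<Rightarrow> real"
  assumes K: "K > 0" and a: "\<And>i. i < K \<Longrightarrow> a i > 0"
  shows "(\<integral>\<^sup>+\<beta>. ennreal (indicator (prob_simplex K) \<beta> * (\<Prod>i<K. \<beta> i powr (a i - 1))) \<partial>simplex_lborel K)
          = ennreal ((\<Prod>i<K. Gamma (a i)) / Gamma (\<Sum>i<K. a i))"
proof -
  obtain k where k: "K = Suc k" using K by (cases K) auto
  have ind: "simplex_chart K x \<in> prob_simplex K \<longleftrightarrow> (\<forall>i\<in>{..<k}. 0 \<le> x i) \<and> (\<Sum>i<k. x i) \<le> 1" for x
    using sum_simplex_chart[OF K, of x]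
    by (auto simp: prob_simplex_def k simplex_chart_def less_Suc_eq)
  have prod: "(\<Prod>i<K. simplex_chart K x i powr (a i - 1))
      = (\<Prod>i<k. x i powr (a i - 1)) * (1 - (\<Sum>i<k. x i)) powr (a k - 1)" for x
    by (simp add: k simplex_chart_def)
  have [measurable]: "prob_simplex K \<in> sets (PiM {..<K} (\<lambda>_. lborel))"
    using prob_simplex_measurable by (simp add: simplex_lborel_def)
  have "(\<integral>\<^sup>+\<beta>. ennreal (indicator (prob_simplex K) \<beta> * (\<Prod>i<K. \<beta> i powr (a i - 1))) \<partial>simplex_lborel K)
      = (\<integral>\<^sup>+x. ennreal (indicator (prob_simplex K) (simplex_chart K x)
            * (\<Prod>i<K. simplex_chart K x i powr (a i - 1))) \<partial>PiM {..<K-1} (\<lambda>_. lborel))"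
    unfolding simplex_lborel_def by (rule nn_integral_distr) measurable
  also have "\<dots> = (\<integral>\<^sup>+x. ennreal (if (\<forall>i\<in>{..<k}. 0 \<le> x i) \<and> (\<Sum>i<k. x i) \<le> 1
            then (\<Prod>i<k. x i powr (a i - 1)) * (1 - (\<Sum>i<k. x i)) powr (a k - 1) else 0)
            \<partial>PiM {..<k} (\<lambda>_. lborel))"
    by (simp only: prod) (auto simp: k ind[unfolded k] indicator_def intro!: nn_integral_cong)
  also have "\<dots> = ennreal ((\<Prod>i<K. Gamma (a i)) / Gamma (\<Sum>i<K. a i))"
    by (subst nn_integral_corner_simplex) (use a in \<open>auto simp: k\<close>)
  finally show ?thesis .
qed

subsection \<open>Gaussian tests of a point against a convex set\<close>

lemma std_gaussian_density_pos: "std_gaussian_density n \<mu> y > 0"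
  unfolding std_gaussian_density_def by (intro prod_pos) (simp add: normal_density_pos)

lemma std_gaussian_density_measurable [measurable (raw)]:
  assumes "\<And>i. i < n \<Longrightarrow> (\<lambda>x. \<mu> x i) \<in> borel_measurable M"
    and "\<And>i. i < n \<Longrightarrow> (\<lambda>x. y x i) \<in> borel_measurable M"
  shows "(\<lambda>x. std_gaussian_density n (\<mu> x) (y x)) \<in> borel_measurable M"
  unfolding std_gaussian_density_def normal_density_def
proof (rule borel_measurable_prod)
  fix i assume "i \<in> {..<n}"
  then have [measurable]: "(\<lambda>x. \<mu> x i) \<in> borel_measurable M" "(\<lambda>x. y x i) \<in> borel_measurable M"
    using assms by auto
  show "(\<lambda>x. 1 / sqrt (2 * pi * 1\<^sup>2) * exp (- (y x i - \<mu> x i)\<^sup>2 / (2 * 1\<^sup>2))) \<in> borel_measurable M"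
    by measurable
qed

text \<open>Completing the square in each coordinate. This likelihood ratio is used twice: as
  exponential tilting in the Chernoff bound and to compare likelihoods near the truth in the
  evidence bound.\<close>

lemma std_gaussian_density_shift:
  "std_gaussian_density n (\<lambda>i. \<mu> i + u i) y
     = std_gaussian_density n \<mu> y * exp ((\<Sum>i<n. u i * (y i - \<mu> i)) - (\<Sum>i<n. (u i)\<^sup>2) / 2)"
proof -
  have "normal_density (\<mu> i + u i) 1 (y i)
      = normal_density (\<mu> i) 1 (y i) * exp (u i * (y i - \<mu> i) - (u i)\<^sup>2 / 2)" for i
    by (simp add: normal_density_def mult_exp_exp power2_eq_square field_simps)
  then show ?thesis
    by (simp add: std_gaussian_density_def prod.distrib exp_sum[symmetric] sum_subtractf
        sum_divide_distrib)
qed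

lemma nn_integral_std_gaussian_density:
  "(\<integral>\<^sup>+y. ennreal (std_gaussian_density n \<mu> y) \<partial>PiM {..<n} (\<lambda>_. lborel)) = 1"
proof -
  have "(\<integral>\<^sup>+y. ennreal (std_gaussian_density n \<mu> y) \<partial>PiM {..<n} (\<lambda>_. lborel))
      = (\<integral>\<^sup>+y. (\<Prod>i<n. ennreal (normal_density (\<mu> i) 1 (y i))) \<partial>PiM {..<n} (\<lambda>_. lborel))"
    by (simp add: std_gaussian_density_def prod_ennreal)
  also have "\<dots> = (\<Prod>i<n. \<integral>\<^sup>+t. ennreal (normal_density (\<mu> i) 1 t) \<partial>lborel)"
    by (rule lborel_prod.product_nn_integral_prod) simp_all
  also have "\<dots> = 1"
    by (simp add: nn_integral_eq_integral normal_density_nonneg)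
  finally show ?thesis .
qed

lemma
  shows space_std_gaussian: "space (std_gaussian n \<mu>) = space (PiM {..<n} (\<lambda>_. lborel :: real measure))"
    and sets_std_gaussian [measurable_cong]: "sets (std_gaussian n \<mu>) = sets (PiM {..<n} (\<lambda>_. lborel :: real measure))"
  by (simp_all add: std_gaussian_def)

text \<open>On the event, the factor \<open>exp (?S - t)\<close> is at least 1. Multiplying the
  density by it gives a constant times the Gaussian density with mean shifted by \<open>u\<close>,
  which has total mass 1. The usual tilting parameter is absorbed into the scale of
  \<open>u\<close>.\<close>

lemma std_gaussian_Chernoff:
  "emeasure (std_gaussian n \<mu>) {y \<in> space (PiM {..<n} (\<lambda>_. lborel)). t \<le> (\<Sum>i<n. u i * (y i - \<mu> i))}
     \<le> ennreal (exp ((\<Sum>i<n. (u i)\<^sup>2) / 2 - t))"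
proof -
  let ?L = "PiM {..<n} (\<lambda>_. lborel :: real measure)"
  let ?A = "{y \<in> space ?L. t \<le> (\<Sum>i<n. u i * (y i - \<mu> i))}"
  let ?q = "(\<Sum>i<n. (u i)\<^sup>2) / 2"
  have [measurable]: "?A \<in> sets ?L" by measurable
  have "emeasure (std_gaussian n \<mu>) ?A = (\<integral>\<^sup>+y. ennreal (std_gaussian_density n \<mu> y) * indicator ?A y \<partial>?L)"
    unfolding std_gaussian_def by (rule emeasure_density) measurable
  also have "\<dots> \<le> (\<integral>\<^sup>+y. ennreal (exp (?q - t)) * ennreal (std_gaussian_density n (\<lambda>i. \<mu> i + u i) y) \<partial>?L)"
  proof (rule nn_integral_mono)
    fix y
    show "ennreal (std_gaussian_density n \<mu> y) * indicator ?A y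
        \<le> ennreal (exp (?q - t)) * ennreal (std_gaussian_density n (\<lambda>i. \<mu> i + u i) y)"
    proof (cases "y \<in> ?A")
      case True
      let ?S = "\<Sum>i<n. u i * (y i - \<mu> i)"
      have "exp (?q - t) * std_gaussian_density n (\<lambda>i. \<mu> i + u i) y
          = std_gaussian_density n \<mu> y * exp (?S - t)"
        by (simp add: std_gaussian_density_shift mult_exp_exp algebra_simps)
      moreover have "std_gaussian_density n \<mu> y * 1 \<le> std_gaussian_density n \<mu> y * exp (?S - t)"
        using True by (intro mult_left_mono) (auto intro: less_imp_le[OF std_gaussian_density_pos])
      ultimately show ?thesis using True
        by (auto simp: ennreal_mult'[symmetric] simp del: ennreal_mult'' intro!: ennreal_leI)
    qed simp
  qed
  also have "\<dots> = ennreal (exp (?q - t))"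
    by (subst nn_integral_cmult) (simp_all add: nn_integral_std_gaussian_density)
  finally show ?thesis .
qed

text \<open>An approximate minimiser of the norm suffices as separating direction, which avoids any
  closedness assumption.\<close>

lemma convex_set_separating_direction:
  fixes C :: "(nat \<Rightarrow> real) set"
  assumes C: "C \<noteq> {}" and \<delta>: "\<delta> > 0"
    and conv: "\<And>u v t. u \<in> C \<Longrightarrow> v \<in> C \<Longrightarrow> 0 \<le> t \<Longrightarrow> t \<le> 1 \<Longrightarrow> (\<lambda>i. u i + t * (v i - u i)) \<in> C"
    and far: "\<And>v. v \<in> C \<Longrightarrow> \<delta> \<le> (\<Sum>i<n. (v i)\<^sup>2)"
    and bdd: "\<And>u v. u \<in> C \<Longrightarrow> v \<in> C \<Longrightarrow> (\<Sum>i<n. (v i - u i)\<^sup>2) \<le> E"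
  obtains u where "u \<in> C" "\<And>v. v \<in> C \<Longrightarrow> 3 / 4 * (\<Sum>i<n. (u i)\<^sup>2) \<le> (\<Sum>i<n. u i * v i)"
proof -
  define N where "N v = (\<Sum>i<n. (v i)\<^sup>2)" for v :: "nat \<Rightarrow> real"
  define m where "m = Inf (N ` C)"
  have m_le: "m \<le> N v" if "v \<in> C" for v
    unfolding m_def by (rule cInf_lower) (use that far in \<open>auto simp: N_def intro!: bdd_belowI[of _ \<delta>]\<close>)
  have "\<delta> \<le> m"
    unfolding m_def by (rule cInf_greatest) (use C far in \<open>auto simp: N_def\<close>)
  then have m: "m > 0" using \<delta> by simp
  have E: "E \<ge> 0"
  proof -
    obtain v where "v \<in> C" using C by auto
    from bdd[OF this this] show ?thesis by simp
  qed
  \<comment> \<open>The step length from \<open>u\<close> towards \<open>v\<close>, short enough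
    that the quadratic term of the squared norm, at most \<open>t * (t * E)\<close>, is at most
    \<open>t * (m / 4)\<close>. The summand 1 keeps the quotient meaningful for
    \<open>E = 0\<close>.\<close>
  define t where "t = min 1 (m / (4 * (E + 1)))"
  have t: "0 < t" "t \<le> 1" using m E by (auto simp: t_def)
  have tE: "t * E \<le> m / 4"
  proof -
    have "t * E \<le> m / (4 * (E + 1)) * (E + 1)"
      using t E m by (intro mult_mono) (auto simp: t_def)
    also have "\<dots> = m / 4" using E by (simp add: divide_simps add_eq_0_iff)
    finally show ?thesis .
  qed
  \<comment> \<open>The point \<open>u\<close> misses the infimum by less than
    \<open>t * m / 4\<close>, again of order \<open>t\<close>, so that dividing by \<open>t\<close>
    below leaves a bound free of \<open>t\<close>.\<close>
  have "Inf (N ` C) < m + t * m / 4" using t m by (simp add: m_def[symmetric])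
  then obtain u where u: "u \<in> C" "N u < m + t * m / 4"
    using cInf_lessD[of "N ` C"] C by blast
  have "3 / 4 * N u \<le> (\<Sum>i<n. u i * v i)" if v: "v \<in> C" for v
  proof -
    define S where "S = (\<Sum>i<n. u i * v i)"
    \<comment> \<open>Approximate first-order optimality: moving from \<open>u\<close> towards
      \<open>v\<close> cannot go below \<open>m\<close>. After division by \<open>t\<close> this
      gives \<open>S \<ge> N u - m / 4\<close>, and \<open>m \<le> N u\<close> turns it into the
      factor 3/4.\<close>
    have "m \<le> N (\<lambda>i. u i + t * (v i - u i))" by (intro m_le conv u v) (use t in auto)
    also have "\<dots> = N u + 2 * t * (S - N u) + t\<^sup>2 * (\<Sum>i<n. (v i - u i)\<^sup>2)"
      unfolding N_def S_def
      by (simp add: sum_distrib_left sum.distrib[symmetric] sum_subtractf[symmetric])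
         (intro sum.cong refl, simp add: power2_eq_square algebra_simps)
    also have "t\<^sup>2 * (\<Sum>i<n. (v i - u i)\<^sup>2) \<le> t\<^sup>2 * E" by (intro mult_left_mono bdd u v) simp
    also have "t\<^sup>2 * E = t * (t * E)" by (simp add: power2_eq_square)
    also have "\<dots> \<le> t * (m / 4)" using t tE by (intro mult_left_mono) auto
    finally have "0 \<le> t * (m / 4 + 2 * (S - N u) + m / 4)" using u by (simp add: algebra_simps)
    then have "0 \<le> m / 4 + 2 * (S - N u) + m / 4" using t by (simp add: zero_le_mult_iff)
    moreover have "m \<le> N u" by (intro m_le u)
    ultimately show ?thesis by (simp add: S_def[symmetric])
  qed
  with u(1) show thesis by (intro that) (auto simp: N_def)
qed

text \<open>The test thresholds the inner product of \<open>y - \<mu>0\<close> with an approximately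
  shortest vector \<open>u\<close> of the translate of \<open>C\<close> by \<open>-\<mu>0\<close>.
  With \<open>q\<close> the squared norm of \<open>u\<close>, this statistic has variance
  \<open>q\<close>, mean 0 under \<open>\<mu>0\<close> and mean at least \<open>3 / 4 * q\<close>
  for every mean in \<open>C\<close>. The threshold \<open>q / 2\<close> thus lies
  \<open>q / 2\<close> above the former mean and at least \<open>q / 4\<close> below the
  latter.\<close>

lemma std_gaussian_convex_test:
  fixes C :: "(nat \<Rightarrow> real) set" and \<mu>0 :: "nat \<Rightarrow> real"
  assumes \<delta>: "\<delta> > 0"
    and conv: "\<And>u v t. u \<in> C \<Longrightarrow> v \<in> C \<Longrightarrow> 0 \<le> t \<Longrightarrow> t \<le> 1 \<Longrightarrow> (\<lambda>i. u i + t * (v i - u i)) \<in> C"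
    and far: "\<And>v. v \<in> C \<Longrightarrow> \<delta> \<le> (\<Sum>i<n. (v i - \<mu>0 i)\<^sup>2)"
    and bdd: "\<And>u v. u \<in> C \<Longrightarrow> v \<in> C \<Longrightarrow> (\<Sum>i<n. (v i - u i)\<^sup>2) \<le> E"
  obtains F where "F \<in> sets (PiM {..<n} (\<lambda>_. lborel :: real measure))"
    "emeasure (std_gaussian n \<mu>0) F \<le> ennreal (exp (- \<delta> / 8))"
    "\<And>\<mu>. \<mu> \<in> C \<Longrightarrow> emeasure (std_gaussian n \<mu>) (space (PiM {..<n} (\<lambda>_. lborel :: real measure)) - F)
        \<le> ennreal (exp (- \<delta> / 32))"
proof (cases "C = {}")
  case True
  then show thesis by (intro that[of "{}"]) auto
next
  case False
  let ?L = "PiM {..<n} (\<lambda>_. lborel :: real measure)"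
  let ?C = "(\<lambda>v i. v i - \<mu>0 i) ` C"
  have "\<exists>u\<in>?C. \<forall>v\<in>?C. 3 / 4 * (\<Sum>i<n. (u i)\<^sup>2) \<le> (\<Sum>i<n. u i * v i)"
  proof (rule convex_set_separating_direction[of ?C \<delta> n E])
    fix u v t assume "u \<in> ?C" "v \<in> ?C" and t: "0 \<le> t" "t \<le> (1::real)"
    then obtain u' v' where uv: "u' \<in> C" "v' \<in> C" "u = (\<lambda>i. u' i - \<mu>0 i)" "v = (\<lambda>i. v' i - \<mu>0 i)"
      by auto
    show "(\<lambda>i. u i + t * (v i - u i)) \<in> ?C"
      using conv[OF uv(1,2) t]
      by (intro image_eqI[of _ _ "\<lambda>i. u' i + t * (v' i - u' i)"]) (auto simp: uv(3,4) algebra_simps)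
  next
    fix v assume "v \<in> ?C"
    then show "\<delta> \<le> (\<Sum>i<n. (v i)\<^sup>2)" using far by auto
  next
    fix u v assume "u \<in> ?C" "v \<in> ?C"
    then show "(\<Sum>i<n. (v i - u i)\<^sup>2) \<le> E" using bdd by auto
  next
    fix u assume "u \<in> ?C" "\<And>v. v \<in> ?C \<Longrightarrow> 3 / 4 * (\<Sum>i<n. (u i)\<^sup>2) \<le> (\<Sum>i<n. u i * v i)"
    then show "\<exists>u\<in>?C. \<forall>v\<in>?C. 3 / 4 * (\<Sum>i<n. (u i)\<^sup>2) \<le> (\<Sum>i<n. u i * v i)"
      by (intro bexI[of _ u] ballI)
  qed (use False \<delta> in auto)
  then obtain u where uC: "u \<in> ?C" and u': "\<forall>v\<in>?C. 3 / 4 * (\<Sum>i<n. (u i)\<^sup>2) \<le> (\<Sum>i<n. u i * v i)"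
    by (rule bexE)
  note u = bspec[OF u']
  define q where "q = (\<Sum>i<n. (u i)\<^sup>2)"
  have q: "\<delta> \<le> q" using uC far by (auto simp: q_def)
  \<comment> \<open>The threshold \<open>q / 2\<close> for the inner product with \<open>u\<close>,
    halved on both sides: \<open>u / 2\<close> is the optimal Chernoff tilt and gives
    \<open>exp (- q / 8)\<close>.\<close>
  define F where "F = {y \<in> space ?L. q / 4 \<le> (\<Sum>i<n. (u i / 2) * (y i - \<mu>0 i))}"
  show thesis
  proof (rule that[of F])
    show "F \<in> sets ?L" unfolding F_def by measurable
    have "(\<Sum>i<n. (u i / 2)\<^sup>2) = q / 4" by (simp add: q_def power_divide sum_divide_distrib)
    then have "emeasure (std_gaussian n \<mu>0) F \<le> ennreal (exp (q / 4 / 2 - q / 4))"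
      using std_gaussian_Chernoff[of n \<mu>0 "q / 4" "\<lambda>i. u i / 2"] by (simp only: F_def)
    also have "\<dots> \<le> ennreal (exp (- \<delta> / 8))" using q by (intro ennreal_leI) simp
    finally show "emeasure (std_gaussian n \<mu>0) F \<le> ennreal (exp (- \<delta> / 8))" .
  next
    fix \<mu> assume \<mu>: "\<mu> \<in> C"
    have uv: "3 / 4 * q \<le> (\<Sum>i<n. u i * (\<mu> i - \<mu>0 i))"
      using u[of "\<lambda>i. \<mu> i - \<mu>0 i"] \<mu> by (auto simp: q_def)
    \<comment> \<open>Acceptance forces the statistic to fall at least \<open>q / 4\<close> below
      its mean under \<open>\<mu>\<close>. The optimal tilt is now \<open>- u / 4\<close>, which
      gives \<open>exp (- q / 32)\<close>.\<close>
    have sub: "space ?L - F \<subseteq> {y \<in> space ?L. q / 16 \<le> (\<Sum>i<n. (- u i / 4) * (y i - \<mu> i))}"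
    proof
      fix y assume y: "y \<in> space ?L - F"
      have "(\<Sum>i<n. (- u i / 4) * (y i - \<mu> i))
          = (\<Sum>i<n. u i * (\<mu> i - \<mu>0 i)) / 4 - (\<Sum>i<n. (u i / 2) * (y i - \<mu>0 i)) / 2"
        unfolding sum_divide_distrib sum_subtractf[symmetric]
        by (intro sum.cong refl) (simp add: field_simps)
      moreover have "(\<Sum>i<n. (u i / 2) * (y i - \<mu>0 i)) < q / 4" using y unfolding F_def by (auto simp del: times_divide_eq_left simp: not_le)
      ultimately show "y \<in> {y \<in> space ?L. q / 16 \<le> (\<Sum>i<n. (- u i / 4) * (y i - \<mu> i))}"
        using uv y by simp
    qed
    have "(\<Sum>i<n. (- u i / 4)\<^sup>2) = q / 16" by (simp add: q_def power_divide sum_divide_distrib)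
    then have "emeasure (std_gaussian n \<mu>) {y \<in> space ?L. q / 16 \<le> (\<Sum>i<n. (- u i / 4) * (y i - \<mu> i))}
        \<le> ennreal (exp (q / 16 / 2 - q / 16))"
      using std_gaussian_Chernoff[of n \<mu> "q / 16" "\<lambda>i. - u i / 4"] by (simp only:)
    also have "\<dots> \<le> ennreal (exp (- \<delta> / 32))" using q by (intro ennreal_leI) simp
    finally show "emeasure (std_gaussian n \<mu>) (space ?L - F) \<le> ennreal (exp (- \<delta> / 32))"
      by (intro order.trans[OF emeasure_mono[OF sub]]) (simp_all add: sets_std_gaussian)
  qed
qed

subsection \<open>Dirichlet moments and concentration\<close>

lemma sets_simplex_lborel [measurable_cong]: "sets (simplex_lborel K) = sets (PiM {..<K} (\<lambda>_. lborel :: real measure))"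
  by (simp add: simplex_lborel_def)

text \<open>The indicator is part of the density, so that moments are plain integrals over the
  reference measure.\<close>

definition Dirichlet_density :: "nat \<Rightarrow> (nat \<Rightarrow> real) \<Rightarrow> (nat \<Rightarrow> real) \<Rightarrow> real" where
  "Dirichlet_density K a \<beta> = indicator (prob_simplex K) \<beta>
     * (Gamma (\<Sum>i<K. a i) / (\<Prod>i<K. Gamma (a i)) * (\<Prod>i<K. \<beta> i powr (a i - 1)))"

lemma Dirichlet_density_measurable [measurable]:
  "Dirichlet_density K a \<in> borel_measurable (simplex_lborel K)"
  unfolding Dirichlet_density_def by measurable

lemma Dirichlet_density_nonneg:
  assumes "K > 0" "\<And>i. i < K \<Longrightarrow> a i > 0"
  shows "Dirichlet_density K a \<beta> \<ge> 0"
proof -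
  have "(\<Sum>i<K. a i) > 0" using assms by (intro sum_pos) auto
  then show ?thesis unfolding Dirichlet_density_def using assms(2)
    by (intro mult_nonneg_nonneg divide_nonneg_nonneg prod_nonneg)
       (auto intro!: less_imp_le Gamma_real_pos)
qed

lemma has_bochner_integral_Dirichlet_density:
  assumes K: "K > 0" and a: "\<And>i. i < K \<Longrightarrow> a i > 0"
  shows "has_bochner_integral (simplex_lborel K) (Dirichlet_density K a) 1"
proof (rule has_bochner_integral_nn_integral)
  have A: "(\<Sum>i<K. a i) > 0" using assms by (intro sum_pos) auto
  have P: "(\<Prod>i<K. Gamma (a i)) > 0" using a by (intro prod_pos) auto
  let ?c = "Gamma (\<Sum>i<K. a i) / (\<Prod>i<K. Gamma (a i))"
  have c: "?c > 0" using A P by simp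
  have "(\<integral>\<^sup>+\<beta>. ennreal (Dirichlet_density K a \<beta>) \<partial>simplex_lborel K)
      = (\<integral>\<^sup>+\<beta>. ennreal ?c * ennreal (indicator (prob_simplex K) \<beta> * (\<Prod>i<K. \<beta> i powr (a i - 1))) \<partial>simplex_lborel K)"
    using c by (intro nn_integral_cong) (simp add: Dirichlet_density_def ennreal_mult'[symmetric] mult_ac del: ennreal_mult'')
  also have "\<dots> = ennreal ?c
      * (\<integral>\<^sup>+\<beta>. ennreal (indicator (prob_simplex K) \<beta> * (\<Prod>i<K. \<beta> i powr (a i - 1))) \<partial>simplex_lborel K)"
    by (rule nn_integral_cmult) measurable
  also have "(\<integral>\<^sup>+\<beta>. ennreal (indicator (prob_simplex K) \<beta> * (\<Prod>i<K. \<beta> i powr (a i - 1))) \<partial>simplex_lborel K)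
      = ennreal ((\<Prod>i<K. Gamma (a i)) / Gamma (\<Sum>i<K. a i))"
    by (rule nn_integral_Dirichlet[OF assms])
  also have "ennreal ?c * ennreal ((\<Prod>i<K. Gamma (a i)) / Gamma (\<Sum>i<K. a i)) = ennreal 1"
  proof -
    have "x / y * (y / x) = 1" if "x > 0" "y > 0" for x y :: real using that by simp
    from this[OF Gamma_real_pos[OF A] P] show ?thesis
      using c by (simp only: ennreal_mult'[symmetric] less_imp_le)
  qed
  finally show "(\<integral>\<^sup>+\<beta>. ennreal (Dirichlet_density K a \<beta>) \<partial>simplex_lborel K) = ennreal 1" .
qed (use Dirichlet_density_nonneg[OF assms] in auto)

text \<open>Size biasing: the factor \<open>\<beta> i\<close> raises the \<open>i\<close>-th
  exponent by one, and the functional equation of Gamma adjusts the normalising constant. Applied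
  once or twice, it reduces the first two moments to the total mass 1 of another Dirichlet
  density.\<close>

lemma Dirichlet_density_shift:
  assumes K: "K > 0" and a: "\<And>j. j < K \<Longrightarrow> a j > 0" and i: "i < K"
  shows "\<beta> i * Dirichlet_density K a \<beta>
          = a i / (\<Sum>j<K. a j) * Dirichlet_density K (a(i := a i + 1)) \<beta>"
proof (cases "\<beta> \<in> prob_simplex K")
  case True
  then have \<beta>i: "\<beta> i \<ge> 0" using i by (auto simp: prob_simplex_def)
  let ?I = "{..<K} - {i}"
  have A: "(\<Sum>j<K. a j) > 0" using K a by (intro sum_pos) auto
  have ai: "a i > 0" using a i by simp
  have "(\<Sum>j\<in>?I. (a(i := a i + 1)) j) = (\<Sum>j\<in>?I. a j)" by (intro sum.cong) auto
  then have 1: "(\<Sum>j<K. (a(i := a i + 1)) j) = (\<Sum>j<K. a j) + 1"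
    using i by (subst (1 2) sum.remove[of _ i]) auto
  have "(\<Prod>j\<in>?I. Gamma ((a(i := a i + 1)) j)) = (\<Prod>j\<in>?I. Gamma (a j))" by (intro prod.cong) auto
  then have 2: "(\<Prod>j<K. Gamma ((a(i := a i + 1)) j)) = a i * (\<Prod>j<K. Gamma (a j))"
    using i ai by (subst (1 2) prod.remove[of _ i]) (auto simp: Gamma_plus1 nonpos_Ints_def)
  have "(\<Prod>j\<in>?I. \<beta> j powr ((a(i := a i + 1)) j - 1)) = (\<Prod>j\<in>?I. \<beta> j powr (a j - 1))" by (intro prod.cong) auto
  moreover have "\<beta> i powr a i = \<beta> i * \<beta> i powr (a i - 1)"
    using \<beta>i powr_add[of "\<beta> i" 1 "a i - 1"] by simp
  ultimately have 3: "(\<Prod>j<K. \<beta> j powr ((a(i := a i + 1)) j - 1)) = \<beta> i * (\<Prod>j<K. \<beta> j powr (a j - 1))"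
    using i by (subst (1 2) prod.remove[of _ i]) auto
  have 4: "Gamma ((\<Sum>j<K. a j) + 1) = (\<Sum>j<K. a j) * Gamma (\<Sum>j<K. a j)"
    using A by (intro Gamma_plus1) (auto simp: nonpos_Ints_def)
  show ?thesis using True A ai unfolding Dirichlet_density_def 1 2 3 4 by simp
qed (simp add: Dirichlet_density_def)

lemma has_bochner_integral_Dirichlet_moment1:
  assumes K: "K > 0" and a: "\<And>j. j < K \<Longrightarrow> a j > 0" and i: "i < K"
  shows "has_bochner_integral (simplex_lborel K) (\<lambda>\<beta>. \<beta> i * Dirichlet_density K a \<beta>) (a i / (\<Sum>j<K. a j))"
proof -
  have "has_bochner_integral (simplex_lborel K)
      (\<lambda>\<beta>. a i / (\<Sum>j<K. a j) * Dirichlet_density K (a(i := a i + 1)) \<beta>) (a i / (\<Sum>j<K. a j) * 1)"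
    using K a i
    by (intro has_bochner_integral_mult_right has_bochner_integral_Dirichlet_density) (auto intro: add_pos_pos)
  moreover have "(\<lambda>\<beta>. \<beta> i * Dirichlet_density K a \<beta>)
      = (\<lambda>\<beta>. a i / (\<Sum>j<K. a j) * Dirichlet_density K (a(i := a i + 1)) \<beta>)"
    by (rule ext) (rule Dirichlet_density_shift[OF assms])
  ultimately show ?thesis by (simp only: mult_1_right)
qed

lemma has_bochner_integral_Dirichlet_moment2:
  assumes K: "K > 0" and a: "\<And>j. j < K \<Longrightarrow> a j > 0" and i: "i < K"
  shows "has_bochner_integral (simplex_lborel K) (\<lambda>\<beta>. (\<beta> i)\<^sup>2 * Dirichlet_density K a \<beta>)
           (a i * (a i + 1) / ((\<Sum>j<K. a j) * ((\<Sum>j<K. a j) + 1)))"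
proof -
  let ?a = "a(i := a i + 1)"
  have a': "\<And>j. j < K \<Longrightarrow> ?a j > 0" using a by (auto intro: add_pos_pos)
  have "(\<Sum>j\<in>{..<K} - {i}. ?a j) = (\<Sum>j\<in>{..<K} - {i}. a j)" by (intro sum.cong) auto
  then have A': "(\<Sum>j<K. ?a j) = (\<Sum>j<K. a j) + 1"
    using i by (subst (1 2) sum.remove[of _ i]) auto
  have "has_bochner_integral (simplex_lborel K)
      (\<lambda>\<beta>. a i / (\<Sum>j<K. a j) * (\<beta> i * Dirichlet_density K ?a \<beta>)) (a i / (\<Sum>j<K. a j) * (?a i / (\<Sum>j<K. ?a j)))"
    by (intro has_bochner_integral_mult_right has_bochner_integral_Dirichlet_moment1 K a' i)
  moreover have "a i / (\<Sum>j<K. a j) * (\<beta> i * Dirichlet_density K ?a \<beta>) = (\<beta> i)\<^sup>2 * Dirichlet_density K a \<beta>" for \<beta>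
  proof -
    have "a i / (\<Sum>j<K. a j) * (\<beta> i * Dirichlet_density K ?a \<beta>)
        = \<beta> i * (a i / (\<Sum>j<K. a j) * Dirichlet_density K ?a \<beta>)" by simp
    also have "\<dots> = \<beta> i * (\<beta> i * Dirichlet_density K a \<beta>)"
      by (rule arg_cong[where f = "(*) (\<beta> i)"], rule sym) (rule Dirichlet_density_shift[OF assms])
    also have "\<dots> = (\<beta> i)\<^sup>2 * Dirichlet_density K a \<beta>"
      by (simp add: power2_eq_square)
    finally show ?thesis .
  qed
  ultimately show ?thesis by (simp add: A' fun_upd_same del: fun_upd_apply)
qed

text \<open>Markov's inequality for the squared distance on \<open>S\<close>. Its expectation is at
  most \<open>2 / (real s * \<rho>)\<close>, so the set where it exceeds
  \<open>5 / (real s * \<rho>)\<close> has mass at most 2/5. The hypothesis \<open>rest\<close> says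
  that the parameters outside \<open>S\<close> add up to at most \<open>sqrt \<rho>\<close>, which
  keeps the squared bias of the mean no larger than the bound for the variance.\<close>

lemma Dirichlet_concentration:
  assumes K: "K > 0" and a: "\<And>j. j < K \<Longrightarrow> a j > 0"
    and S: "S \<subseteq> {..<K}" "card S = s" "s > 0" and aS: "\<And>j. j \<in> S \<Longrightarrow> a j = \<rho>"
    and rest: "((\<Sum>j<K. a j) - real s * \<rho>)\<^sup>2 \<le> \<rho>"
  shows "ennreal (1 / 2) \<le> (\<integral>\<^sup>+\<beta>. ennreal (Dirichlet_density K a \<beta>
           * indicator {\<beta>. (\<Sum>i\<in>S. (\<beta> i - 1 / real s)\<^sup>2) \<le> 5 / (real s * \<rho>)} \<beta>) \<partial>simplex_lborel K)"
proof -
  define A where "A = (\<Sum>j<K. a j)"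
  define Q :: "(nat \<Rightarrow> real) \<Rightarrow> real" where "Q \<beta> = (\<Sum>i\<in>S. (\<beta> i - 1 / real s)\<^sup>2)" for \<beta>
  define f where "f = Dirichlet_density K a"
  \<comment> \<open>The exact expectation of \<open>Q\<close>, obtained by expanding the square and
    inserting the first two moments.\<close>
  define q where "q = real s * (\<rho> * (\<rho> + 1) / (A * (A + 1)) - 2 / real s * (\<rho> / A) + 1 / (real s)\<^sup>2)"
  have fin: "finite S" using S(1) finite_subset by blast
  have sub: "i < K" if "i \<in> S" for i using that S(1) by auto
  have [measurable]: "f \<in> borel_measurable (simplex_lborel K)" by (simp add: f_def)
  have [measurable]: "Q \<in> borel_measurable (simplex_lborel K)"
    unfolding Q_def by measurable (auto simp: sub)
  obtain j where j: "j \<in> S" using S by (metis card.empty ex_in_conv less_irrefl)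
  have \<rho>: "\<rho> > 0" using a[OF sub[OF j]] aS[OF j] by simp
  have s1: "real s \<ge> 1" using S by simp
  have "real s * \<rho> = (\<Sum>i\<in>S. a i)" using S(2) aS by simp
  also have "\<dots> \<le> A" unfolding A_def using S(1) a by (intro sum_mono2) (auto intro: less_imp_le)
  finally have As: "real s * \<rho> \<le> A" .
  have sr: "0 < real s * \<rho>" using s1 \<rho> by simp
  have A: "A > 0" using As sr by simp
  have f0: "f \<beta> \<ge> 0" for \<beta> unfolding f_def by (rule Dirichlet_density_nonneg[OF K a])
  have Q0: "Q \<beta> \<ge> 0" for \<beta> unfolding Q_def by (intro sum_nonneg) simp

  have "has_bochner_integral (simplex_lborel K) (\<lambda>\<beta>. \<Sum>i\<in>S. ((\<beta> i)\<^sup>2 * f \<beta> - 2 / real s * (\<beta> i * f \<beta>) + 1 / (real s)\<^sup>2 * f \<beta>))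
      (\<Sum>i\<in>S. (a i * (a i + 1) / (A * (A + 1)) - 2 / real s * (a i / A) + 1 / (real s)\<^sup>2 * 1))"
    unfolding f_def A_def
    by (intro has_bochner_integral_sum has_bochner_integral_add has_bochner_integral_diff
        has_bochner_integral_mult_right has_bochner_integral_Dirichlet_moment1
        has_bochner_integral_Dirichlet_moment2 has_bochner_integral_Dirichlet_density K a) (auto intro: sub)
  moreover have "(\<Sum>i\<in>S. ((\<beta> i)\<^sup>2 * f \<beta> - 2 / real s * (\<beta> i * f \<beta>) + 1 / (real s)\<^sup>2 * f \<beta>)) = Q \<beta> * f \<beta>" for \<beta>
    unfolding Q_def sum_distrib_right
    by (intro sum.cong refl) (simp add: power2_diff power_divide algebra_simps)
  moreover have "(\<Sum>i\<in>S. (a i * (a i + 1) / (A * (A + 1)) - 2 / real s * (a i / A) + 1 / (real s)\<^sup>2 * 1)) = q"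
    using S(2) aS by (simp add: q_def)
  ultimately have intQ: "has_bochner_integral (simplex_lborel K) (\<lambda>\<beta>. Q \<beta> * f \<beta>) q" by simp

  have q: "q \<le> 2 / (real s * \<rho>)"
  proof -
    \<comment> \<open>Variance plus squared bias of one coordinate. Each is bounded by
      \<open>\<rho> / A\<^sup>2\<close>: the variance because its remaining factor is at most 1, the
      bias by \<open>rest\<close>.\<close>
    have "\<rho> * (\<rho> + 1) / (A * (A + 1)) - 2 / real s * (\<rho> / A) + 1 / (real s)\<^sup>2
        = \<rho> * (A - \<rho>) / (A\<^sup>2 * (A + 1)) + (A - real s * \<rho>)\<^sup>2 / ((real s)\<^sup>2 * A\<^sup>2)"
      using A s1 by (simp add: divide_simps) (simp add: power2_eq_square algebra_simps)
    also have "\<rho> * (A - \<rho>) / (A\<^sup>2 * (A + 1)) \<le> \<rho> / A\<^sup>2"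
    proof -
      have "\<rho> * (A - \<rho>) / (A\<^sup>2 * (A + 1)) = \<rho> / A\<^sup>2 * ((A - \<rho>) / (A + 1))" by simp
      also have "\<dots> \<le> \<rho> / A\<^sup>2 * 1" using A \<rho> by (intro mult_left_mono) auto
      finally show ?thesis by simp
    qed
    also have "(A - real s * \<rho>)\<^sup>2 / ((real s)\<^sup>2 * A\<^sup>2) \<le> \<rho> / (1 * A\<^sup>2)"
      using rest A \<rho> s1 by (intro frac_le mult_right_mono) (auto simp: A_def)
    also have "\<rho> / A\<^sup>2 + \<rho> / (1 * A\<^sup>2) = 2 * \<rho> / A\<^sup>2" by simp
    also have "\<dots> \<le> 2 * \<rho> / (real s * \<rho>)\<^sup>2"
      using As sr \<rho> A by (intro divide_left_mono power_mono mult_pos_pos zero_less_power) (use S(3) in auto)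
    finally have "q \<le> real s * (2 * \<rho> / (real s * \<rho>)\<^sup>2)"
      unfolding q_def using s1 by (intro mult_left_mono) auto
    then show ?thesis using s1 \<rho> by (simp add: power2_eq_square field_simps)
  qed
  let ?N = "{\<beta>. Q \<beta> \<le> 5 / (real s * \<rho>)}"
  let ?c = "real s * \<rho> / 5"
  have [measurable]: "Measurable.pred (simplex_lborel K) (\<lambda>\<beta>. \<beta> \<in> ?N)" by simp
  \<comment> \<open>The pointwise form of Markov's inequality: off \<open>?N\<close> the factor
    \<open>?c * Q \<beta>\<close> is at least 1.\<close>
  have split: "ennreal (f \<beta>) \<le> ennreal (f \<beta> * indicator ?N \<beta>) + ennreal (?c * (Q \<beta> * f \<beta>))" for \<beta>
  proof (cases "\<beta> \<in> ?N")
    case False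
    then have "1 \<le> ?c * Q \<beta>" using sr by (simp add: field_simps)
    then have "1 * f \<beta> \<le> ?c * Q \<beta> * f \<beta>" using f0 by (intro mult_right_mono) auto
    then show ?thesis using False by (auto intro!: ennreal_leI)
  qed simp
  have "1 = (\<integral>\<^sup>+\<beta>. ennreal (f \<beta>) \<partial>simplex_lborel K)"
    using has_bochner_integral_Dirichlet_density[OF K a] f0
    by (subst nn_integral_eq_integral) (auto simp: f_def has_bochner_integral_iff)
  also have "\<dots> \<le> (\<integral>\<^sup>+\<beta>. ennreal (f \<beta> * indicator ?N \<beta>) + ennreal (?c * (Q \<beta> * f \<beta>)) \<partial>simplex_lborel K)"
    by (intro nn_integral_mono split)
  also have "\<dots> = (\<integral>\<^sup>+\<beta>. ennreal (f \<beta> * indicator ?N \<beta>) \<partial>simplex_lborel K) + (\<integral>\<^sup>+\<beta>. ennreal (?c * (Q \<beta> * f \<beta>)) \<partial>simplex_lborel K)"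
    by (rule nn_integral_add) measurable
  also have "(\<integral>\<^sup>+\<beta>. ennreal (?c * (Q \<beta> * f \<beta>)) \<partial>simplex_lborel K) = ennreal (?c * q)"
    using has_bochner_integral_mult_right[of ?c, OF intQ] f0 Q0 sr
    by (subst nn_integral_eq_integral) (auto simp: has_bochner_integral_iff)
  also have "\<dots> \<le> ennreal (1 / 2)"
  proof (rule ennreal_leI)
    have "?c * q \<le> ?c * (2 / (real s * \<rho>))" using q sr by (intro mult_left_mono) auto
    also have "\<dots> \<le> 1 / 2" using s1 \<rho> by simp
    finally show "?c * q \<le> 1 / 2" .
  qed
  finally have "1 \<le> (\<integral>\<^sup>+\<beta>. ennreal (f \<beta> * indicator ?N \<beta>) \<partial>simplex_lborel K) + ennreal (1 / 2)" by simp
  then have "1 - ennreal (1 / 2) \<le> (\<integral>\<^sup>+\<beta>. ennreal (f \<beta> * indicator ?N \<beta>) \<partial>simplex_lborel K)"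
    by (subst ennreal_minus_le_iff) (auto simp: add.commute)
  also have "1 - ennreal (1 / 2) = ennreal (1 / 2)"
    by (subst ennreal_1[symmetric], subst ennreal_minus) auto
  finally show ?thesis by (simp add: f_def Q_def)
qed

subsection \<open>The prior as a mixture of Dirichlet distributions\<close>

lemma prod_binary_powers:
  fixes x y :: real
  assumes "\<gamma> \<in> {..<K} \<rightarrow>\<^sub>E {0, 1 :: nat}"
  shows "(\<Prod>i<K. x ^ \<gamma> i * y ^ (1 - \<gamma> i)) = x ^ (\<Sum>i<K. \<gamma> i) * y ^ (K - (\<Sum>i<K. \<gamma> i))"
proof -
  have le: "\<gamma> i \<le> 1" if "i < K" for i
  proof -
    have "\<gamma> i \<in> {0, 1}" using assms that by (intro PiE_mem[of \<gamma> "{..<K}"]) auto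
    then show ?thesis by auto
  qed
  have "(\<Sum>i<K. 1 - \<gamma> i) = K - (\<Sum>i<K. \<gamma> i)"
    using le by (subst sum_subtractf_nat) auto
  then show ?thesis by (simp add: prod.distrib power_sum[symmetric])
qed

text \<open>The Gamma quotient in the prior is exactly the normalising constant of the component
  selected by \<open>\<gamma>\<close>. The Bernoulli weights are written as products over
  coordinates so that they sum to 1 by expanding a product of factors
  \<open>\<theta> + (1 - \<theta>)\<close>.\<close>

lemma double_spike_dirichlet_density_mixture:
  assumes "\<beta> \<in> prob_simplex K" "\<rho>1 > 0" "\<rho>2 > 0"
  shows "double_spike_dirichlet_density K \<theta> \<rho>1 \<rho>2 \<beta> =
     (\<Sum>\<gamma> \<in> {..<K} \<rightarrow>\<^sub>E {0, 1 :: nat}. (\<Prod>i<K. \<theta> ^ \<gamma> i * (1 - \<theta>) ^ (1 - \<gamma> i))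
        * Dirichlet_density K (\<lambda>i. \<rho>1 * real (\<gamma> i) + \<rho>2 * (1 - real (\<gamma> i))) \<beta>)"
  unfolding double_spike_dirichlet_density_def Let_def
proof (intro sum.cong refl)
  fix \<gamma> :: "nat \<Rightarrow> nat" assume \<gamma>: "\<gamma> \<in> {..<K} \<rightarrow>\<^sub>E {0, 1}"
  let ?m = "\<Sum>i<K. \<gamma> i"
  have \<gamma>01: "\<gamma> i = 0 \<or> \<gamma> i = 1" if "i < K" for i
  proof -
    have "\<gamma> i \<in> {0, 1}" using \<gamma> that by (intro PiE_mem[of \<gamma> "{..<K}"]) auto
    then show ?thesis by auto
  qed
  have "?m \<le> (\<Sum>i<K. 1)" using \<gamma>01 by (intro sum_mono) force
  then have m: "?m \<le> K" by simp
  have "(\<Sum>i<K. \<rho>1 * real (\<gamma> i) + \<rho>2 * (1 - real (\<gamma> i))) = \<rho>1 * real ?m + \<rho>2 * real (K - ?m)"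
    using m by (simp add: sum.distrib sum_distrib_left[symmetric] sum_subtractf of_nat_diff)
  moreover have "(\<Prod>i<K. Gamma (\<rho>1 * real (\<gamma> i) + \<rho>2 * (1 - real (\<gamma> i))))
      = (\<Prod>i<K. Gamma \<rho>1 ^ \<gamma> i * Gamma \<rho>2 ^ (1 - \<gamma> i))"
    using \<gamma>01 by (intro prod.cong) force+
  ultimately show "Gamma (\<rho>1 * real ?m + \<rho>2 * real (K - ?m)) / (Gamma \<rho>1 ^ ?m * Gamma \<rho>2 ^ (K - ?m))
        * (\<Prod>i<K. \<beta> i powr (\<rho>1 * real (\<gamma> i) + \<rho>2 * (1 - real (\<gamma> i)) - 1))
        * \<theta> ^ ?m * (1 - \<theta>) ^ (K - ?m)
      = (\<Prod>i<K. \<theta> ^ \<gamma> i * (1 - \<theta>) ^ (1 - \<gamma> i))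
        * Dirichlet_density K (\<lambda>i. \<rho>1 * real (\<gamma> i) + \<rho>2 * (1 - real (\<gamma> i))) \<beta>"
    using assms(1) unfolding Dirichlet_density_def by (simp only: prod_binary_powers[OF \<gamma>]) simp
qed

lemma binary_weights_sum:
  fixes K :: nat
  shows "(\<Sum>\<gamma> \<in> {..<K} \<rightarrow>\<^sub>E {0, 1 :: nat}. \<Prod>i<K. \<theta> ^ \<gamma> i * (1 - \<theta> :: real) ^ (1 - \<gamma> i)) = 1"
  by (subst prod_sum_PiE[symmetric]) auto

lemma double_spike_dirichlet_density_measurable [measurable (raw)]:
  assumes "\<And>i. i < K \<Longrightarrow> (\<lambda>x. \<beta> x i) \<in> borel_measurable M"
  shows "(\<lambda>x. double_spike_dirichlet_density K \<theta> \<rho>1 \<rho>2 (\<beta> x)) \<in> borel_measurable M"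
proof -
  have [measurable]: "(\<lambda>x. (\<Prod>i<K. \<beta> x i powr (\<rho>1 * real (\<gamma> i) + \<rho>2 * (1 - real (\<gamma> i)) - 1))) \<in> borel_measurable M"
    for \<gamma> :: "nat \<Rightarrow> nat"
    using assms by (intro borel_measurable_prod powr_real_measurable) auto
  show ?thesis unfolding double_spike_dirichlet_density_def Let_def by measurable
qed

context
  fixes K :: nat and \<theta> \<rho>1 \<rho>2 :: real
  assumes K: "K > 0" and \<theta>: "0 < \<theta>" "\<theta> < 1" and \<rho>: "\<rho>1 > 0" "\<rho>2 > 0"
begin

private lemma params_pos:
  assumes "\<gamma> \<in> {..<K} \<rightarrow>\<^sub>E {0, 1 :: nat}" "i < K"
  shows "\<rho>1 * real (\<gamma> i) + \<rho>2 * (1 - real (\<gamma> i)) > 0"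
proof -
  have "\<gamma> i \<in> {0, 1}" using assms by (intro PiE_mem[of \<gamma> "{..<K}"]) auto
  then show ?thesis using \<rho> by auto
qed

private lemma component_nonneg:
  assumes "\<gamma> \<in> {..<K} \<rightarrow>\<^sub>E {0, 1 :: nat}"
  shows "(\<Prod>i<K. \<theta> ^ \<gamma> i * (1 - \<theta>) ^ (1 - \<gamma> i))
    * Dirichlet_density K (\<lambda>i. \<rho>1 * real (\<gamma> i) + \<rho>2 * (1 - real (\<gamma> i))) \<beta> \<ge> 0"
  by (rule mult_nonneg_nonneg[OF _ Dirichlet_density_nonneg[OF K params_pos[OF assms]]])
     (use \<theta> in \<open>auto intro!: prod_nonneg\<close>)

lemma double_spike_dirichlet_density_nonneg:
  "\<beta> \<in> prob_simplex K \<Longrightarrow> double_spike_dirichlet_density K \<theta> \<rho>1 \<rho>2 \<beta> \<ge> 0"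
  unfolding double_spike_dirichlet_density_mixture[OF _ \<rho>]
  by (rule sum_nonneg) (rule component_nonneg)

text \<open>All terms of the mixture are nonnegative, so any single one may be kept. The evidence
  bound keeps the one matching the support of the true vector.\<close>

lemma double_spike_dirichlet_density_ge:
  assumes "\<beta> \<in> prob_simplex K" "\<gamma> \<in> {..<K} \<rightarrow>\<^sub>E {0, 1 :: nat}"
  shows "\<theta> ^ (\<Sum>i<K. \<gamma> i) * (1 - \<theta>) ^ (K - (\<Sum>i<K. \<gamma> i))
        * Dirichlet_density K (\<lambda>i. \<rho>1 * real (\<gamma> i) + \<rho>2 * (1 - real (\<gamma> i))) \<beta>
      \<le> double_spike_dirichlet_density K \<theta> \<rho>1 \<rho>2 \<beta>"
  unfolding double_spike_dirichlet_density_mixture[OF assms(1) \<rho>] prod_binary_powers[OF assms(2), symmetric]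
proof (rule member_le_sum[where f = "\<lambda>\<gamma>. (\<Prod>i<K. \<theta> ^ \<gamma> i * (1 - \<theta>) ^ (1 - \<gamma> i))
        * Dirichlet_density K (\<lambda>i. \<rho>1 * real (\<gamma> i) + \<rho>2 * (1 - real (\<gamma> i))) \<beta>"])
  fix \<gamma>' assume "\<gamma>' \<in> ({..<K} \<rightarrow>\<^sub>E {0, 1 :: nat}) - {\<gamma>}"
  then show "(\<Prod>i<K. \<theta> ^ \<gamma>' i * (1 - \<theta>) ^ (1 - \<gamma>' i))
      * Dirichlet_density K (\<lambda>i. \<rho>1 * real (\<gamma>' i) + \<rho>2 * (1 - real (\<gamma>' i))) \<beta> \<ge> 0"
    by (intro component_nonneg) (rule DiffD1)
qed (use assms in \<open>auto intro: finite_PiE\<close>)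

text \<open>The total mass lets a uniform type II error bound survive averaging over the prior in
  the numerator of the posterior.\<close>

lemma nn_integral_double_spike_dirichlet_density:
  "(\<integral>\<^sup>+\<beta>\<in>prob_simplex K. ennreal (double_spike_dirichlet_density K \<theta> \<rho>1 \<rho>2 \<beta>) \<partial>simplex_lborel K) = 1"
proof -
  let ?\<Gamma> = "{..<K} \<rightarrow>\<^sub>E {0, 1 :: nat}"
  let ?w = "\<lambda>\<gamma>. \<Prod>i<K. \<theta> ^ \<gamma> i * (1 - \<theta>) ^ (1 - \<gamma> i)"
  let ?f = "\<lambda>\<gamma>. Dirichlet_density K (\<lambda>i. \<rho>1 * real (\<gamma> i) + \<rho>2 * (1 - real (\<gamma> i)))"
  have I: "has_bochner_integral (simplex_lborel K) (\<lambda>\<beta>. \<Sum>\<gamma>\<in>?\<Gamma>. ?w \<gamma> * ?f \<gamma> \<beta>) (\<Sum>\<gamma>\<in>?\<Gamma>. ?w \<gamma> * 1)"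
    by (intro has_bochner_integral_sum has_bochner_integral_mult_right)
       (rule has_bochner_integral_Dirichlet_density[OF K params_pos])
  have "(\<integral>\<^sup>+\<beta>\<in>prob_simplex K. ennreal (double_spike_dirichlet_density K \<theta> \<rho>1 \<rho>2 \<beta>) \<partial>simplex_lborel K)
      = (\<integral>\<^sup>+\<beta>. ennreal (\<Sum>\<gamma>\<in>?\<Gamma>. ?w \<gamma> * ?f \<gamma> \<beta>) \<partial>simplex_lborel K)"
  proof (rule nn_integral_cong)
    fix \<beta>
    show "ennreal (double_spike_dirichlet_density K \<theta> \<rho>1 \<rho>2 \<beta>) * indicator (prob_simplex K) \<beta>
        = ennreal (\<Sum>\<gamma>\<in>?\<Gamma>. ?w \<gamma> * ?f \<gamma> \<beta>)"
      by (cases "\<beta> \<in> prob_simplex K")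
         (simp_all add: double_spike_dirichlet_density_mixture[OF _ \<rho>] Dirichlet_density_def)
  qed
  also have "\<dots> = ennreal (\<Sum>\<gamma>\<in>?\<Gamma>. ?w \<gamma> * 1)"
  proof -
    have "0 \<le> (\<Sum>\<gamma>\<in>?\<Gamma>. ?w \<gamma> * ?f \<gamma> \<beta>)" for \<beta>
      by (rule sum_nonneg) (rule component_nonneg)
    then show ?thesis
      using I by (subst nn_integral_eq_integral) (simp_all only: has_bochner_integral_iff AE_I2)
  qed
  also have "\<dots> = 1" using binary_weights_sum[of \<theta> K] by simp
  finally show ?thesis .
qed

end

subsection \<open>From tests and evidence bounds to posterior bounds\<close>

lemma divide_left_antimono_ennreal:
  fixes a b c :: ennreal
  assumes "a \<le> b"
  shows "c / b \<le> c / a"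
proof -
  from assms have "inverse b \<le> inverse a"
    including ennreal.lifting by transfer (auto intro: ereal_inverse_antimono)
  then show ?thesis unfolding divide_ennreal_def by (rule mult_left_mono) simp
qed

lemma posterior_le_1:
  assumes "B \<subseteq> prob_simplex K"
  shows "posterior n K X \<theta> \<rho>1 \<rho>2 Y B \<le> 1"
proof -
  let ?p = "\<lambda>\<beta>. ennreal (std_gaussian_density n (mat_vec K X \<beta>) Y * double_spike_dirichlet_density K \<theta> \<rho>1 \<rho>2 \<beta>)"
  let ?D = "\<integral>\<^sup>+\<beta>\<in>prob_simplex K. ?p \<beta> \<partial>simplex_lborel K"
  have "(\<integral>\<^sup>+\<beta>\<in>B. ?p \<beta> \<partial>simplex_lborel K) \<le> ?D"
    using assms by (intro nn_integral_mono mult_left_mono) (auto simp: indicator_def)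
  then have "posterior n K X \<theta> \<rho>1 \<rho>2 Y B \<le> ?D / ?D"
    unfolding posterior_def by (rule divide_right_mono_ennreal)
  \<comment> \<open>If the evidence is 0 or infinite, the quotient in \<open>ennreal\<close> is 0,
    so the bound holds for every \<open>Y\<close>.\<close>
  also have "?D / ?D \<le> 1"
    by (cases "?D = 0 \<or> ?D = top") (auto simp: ennreal_divide_self less_top)
  finally show ?thesis .
qed

text \<open>The quantities \<open>F\<close>, \<open>G\<close> and \<open>d\<close> are the rejection region of a test of \<open>\<mu>0\<close> against
  \<open>B\<close>, an event of high probability, and a lower bound on that event for the evidence relative
  to the likelihood at \<open>\<mu>0\<close>.\<close>

lemma nn_integral_posterior_le:
  fixes \<mu>0 :: "nat \<Rightarrow> real"
  assumes K: "K > 0" and \<theta>: "0 < \<theta>" "\<theta> < 1" and \<rho>: "\<rho>1 > 0" "\<rho>2 > 0"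
    and B: "B \<in> sets (simplex_lborel K)" "B \<subseteq> prob_simplex K"
    and F: "F \<in> sets (PiM {..<n} (\<lambda>_. lborel :: real measure))"
    and G: "G \<in> sets (PiM {..<n} (\<lambda>_. lborel :: real measure))"
    and d: "d > 0" and \<epsilon>: "\<epsilon> \<ge> 0"
    and evidence: "\<And>Y. Y \<in> G \<Longrightarrow> ennreal (d * std_gaussian_density n \<mu>0 Y)
      \<le> (\<integral>\<^sup>+\<beta>\<in>prob_simplex K. ennreal (std_gaussian_density n (mat_vec K X \<beta>) Y
                   * double_spike_dirichlet_density K \<theta> \<rho>1 \<rho>2 \<beta>) \<partial>simplex_lborel K)"
    and test: "\<And>\<beta>. \<beta> \<in> B \<Longrightarrow> emeasure (std_gaussian n (mat_vec K X \<beta>))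
        (space (PiM {..<n} (\<lambda>_. lborel :: real measure)) - F) \<le> ennreal \<epsilon>"
  shows "(\<integral>\<^sup>+Y. posterior n K X \<theta> \<rho>1 \<rho>2 Y B \<partial>std_gaussian n \<mu>0)
      \<le> emeasure (std_gaussian n \<mu>0) F
        + emeasure (std_gaussian n \<mu>0) (space (PiM {..<n} (\<lambda>_. lborel :: real measure)) - G)
        + ennreal (\<epsilon> / d)"
proof -
  let ?L = "PiM {..<n} (\<lambda>_. lborel :: real measure)"
  let ?P = "PiM {..<K - 1} (\<lambda>_. lborel :: real measure)"
  let ?g = "double_spike_dirichlet_density K \<theta> \<rho>1 \<rho>2"
  let ?p = "\<lambda>\<beta> Y. std_gaussian_density n (mat_vec K X \<beta>) Y"
  let ?pnull = "std_gaussian_density n \<mu>0"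
  let ?num = "\<lambda>Y. \<integral>\<^sup>+\<beta>\<in>B. ennreal (?p \<beta> Y * ?g \<beta>) \<partial>simplex_lborel K"
  let ?den = "\<lambda>Y. \<integral>\<^sup>+\<beta>\<in>prob_simplex K. ennreal (?p \<beta> Y * ?g \<beta>) \<partial>simplex_lborel K"
  let ?Fc = "space ?L - F" and ?Gc = "space ?L - G"
  note F[measurable] G[measurable]
  have [measurable]: "B \<in> sets (PiM {..<K} (\<lambda>_. lborel))"
    using B(1) by (simp add: sets_simplex_lborel)
  \<comment> \<open>Tonelli's theorem will be applied in chart coordinates, where the reference
    measure is a sigma-finite product of Lebesgue measures.\<close>
  interpret LP: pair_sigma_finite ?L ?P
    by (intro pair_sigma_finite.intro lborel_prod.sigma_finite) auto
  have g0: "?g \<beta> \<ge> 0" if "\<beta> \<in> B" for \<beta>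
    using that B(2) K \<theta> \<rho> by (intro double_spike_dirichlet_density_nonneg) auto
  have p0: "?pnull Y > 0" for Y by (rule std_gaussian_density_pos)

  have meas_k[measurable]: "(\<lambda>(Y, x). ennreal (?p (simplex_chart K x) Y * ?g (simplex_chart K x)) * indicator B (simplex_chart K x))
      \<in> borel_measurable (?L \<Otimes>\<^sub>M ?P)"
  proof -
    have chart[measurable]: "(\<lambda>z. simplex_chart K (snd z) i) \<in> borel_measurable (?L \<Otimes>\<^sub>M ?P)" if "i < K" for i
    proof -
      have "(\<lambda>z. simplex_chart K (snd z)) \<in> ?L \<Otimes>\<^sub>M ?P \<rightarrow>\<^sub>M PiM {..<K} (\<lambda>_. lborel)" by measurable
      from measurable_compose[OF this measurable_component_singleton[of i]] that show ?thesis by simp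
    qed
    have [measurable]: "(\<lambda>z. mat_vec K X (simplex_chart K (snd z)) i) \<in> borel_measurable (?L \<Otimes>\<^sub>M ?P)" for i
      unfolding mat_vec_def
      by (intro borel_measurable_sum borel_measurable_times borel_measurable_const chart) simp
    have [measurable]: "(\<lambda>z. ?p (simplex_chart K (snd z)) (fst z)) \<in> borel_measurable (?L \<Otimes>\<^sub>M ?P)"
      by measurable
    have [measurable]: "(\<lambda>z. ?g (simplex_chart K (snd z))) \<in> borel_measurable (?L \<Otimes>\<^sub>M ?P)"
      by measurable
    show ?thesis unfolding case_prod_unfold by measurable
  qed
  have meas_simplex: "(\<lambda>\<beta>. ennreal (?p \<beta> Y * ?g \<beta>) * indicator B \<beta>) \<in> borel_measurable (PiM {..<K} (\<lambda>_. lborel))" for Y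
  proof -
    have [measurable]: "(\<lambda>\<beta>. mat_vec K X \<beta> i) \<in> borel_measurable (PiM {..<K} (\<lambda>_. lborel))" for i
      unfolding mat_vec_def by measurable
    show ?thesis by measurable
  qed
  have num: "?num Y = (\<integral>\<^sup>+x. ennreal (?p (simplex_chart K x) Y * ?g (simplex_chart K x)) * indicator B (simplex_chart K x) \<partial>?P)" for Y
    unfolding simplex_lborel_def by (rule nn_integral_distr[OF simplex_chart_measurable])
       (simp only: measurable_distr_eq1 meas_simplex)
  have [measurable]: "?num \<in> borel_measurable ?L"
    unfolding num by measurable

  \<comment> \<open>A measurable majorant of the posterior probability: the bound 1 is used where
    the test rejects or the event \<open>G\<close> fails, and elsewhere the denominator is replaced
    by its lower bound \<open>d * ?pnull Y\<close>.\<close>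
  define h where "h Y = indicator F Y + indicator ?Gc Y
      + ennreal (1 / d) * (ennreal (1 / ?pnull Y) * (?num Y * indicator ?Fc Y))" for Y
  have post: "posterior n K X \<theta> \<rho>1 \<rho>2 Y B \<le> h Y" if Y: "Y \<in> space ?L" for Y
  proof (cases "Y \<in> F \<or> Y \<notin> G")
    case True
    have "posterior n K X \<theta> \<rho>1 \<rho>2 Y B \<le> 1" by (rule posterior_le_1[OF B(2)])
    also have "1 \<le> indicator F Y + (indicator ?Gc Y :: ennreal)" using True Y
      by (auto simp: indicator_def)
    also have "\<dots> \<le> h Y" unfolding h_def by simp
    finally show ?thesis .
  next
    case False
    then have "posterior n K X \<theta> \<rho>1 \<rho>2 Y B \<le> ?num Y / ennreal (d * ?pnull Y)"
      unfolding posterior_def by (intro divide_left_antimono_ennreal evidence) auto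
    also have "\<dots> = ennreal (1 / d) * (ennreal (1 / ?pnull Y) * ?num Y)"
      using d p0[of Y] by (simp add: divide_ennreal_def inverse_ennreal ennreal_mult'[symmetric]
          mult.assoc[symmetric] inverse_eq_divide mult.commute[of "?num Y"] del: ennreal_mult'')
    also have "\<dots> \<le> h Y" using False Y unfolding h_def by simp
    finally show ?thesis .
  qed
  have "(\<integral>\<^sup>+Y. posterior n K X \<theta> \<rho>1 \<rho>2 Y B \<partial>std_gaussian n \<mu>0) \<le> (\<integral>\<^sup>+Y. h Y \<partial>std_gaussian n \<mu>0)"
    by (intro nn_integral_mono post) (simp add: space_std_gaussian)
  also have "\<dots> = emeasure (std_gaussian n \<mu>0) F + emeasure (std_gaussian n \<mu>0) ?Gc
      + ennreal (1 / d) * (\<integral>\<^sup>+Y. ennreal (1 / ?pnull Y) * (?num Y * indicator ?Fc Y) \<partial>std_gaussian n \<mu>0)"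
    unfolding h_def by (simp add: nn_integral_add nn_integral_cmult nn_integral_indicator sets_std_gaussian
        cong: measurable_cong_sets)
  \<comment> \<open>Taking the expectation under \<open>\<mu>0\<close> cancels the likelihood at
    \<open>\<mu>0\<close> introduced by the evidence bound. What is left is a Lebesgue integral over
    the acceptance region.\<close>
  also have "(\<integral>\<^sup>+Y. ennreal (1 / ?pnull Y) * (?num Y * indicator ?Fc Y) \<partial>std_gaussian n \<mu>0)
      = (\<integral>\<^sup>+Y. ?num Y * indicator ?Fc Y \<partial>?L)"
  proof -
    have "(\<integral>\<^sup>+Y. ennreal (1 / ?pnull Y) * (?num Y * indicator ?Fc Y) \<partial>std_gaussian n \<mu>0)
      = (\<integral>\<^sup>+Y. ennreal (?pnull Y) * (ennreal (1 / ?pnull Y) * (?num Y * indicator ?Fc Y)) \<partial>?L)"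
      unfolding std_gaussian_def by (rule nn_integral_density) measurable
    also have "\<dots> = (\<integral>\<^sup>+Y. ?num Y * indicator ?Fc Y \<partial>?L)"
    proof (rule nn_integral_cong)
      fix Y
      have "ennreal (?pnull Y) * ennreal (1 / ?pnull Y) = 1"
        using p0[of Y] by (simp add: ennreal_mult'[symmetric] del: ennreal_mult'')
      then show "ennreal (?pnull Y) * (ennreal (1 / ?pnull Y) * (?num Y * indicator ?Fc Y)) = ?num Y * indicator ?Fc Y"
        by (simp add: mult.assoc[symmetric])
    qed
    finally show ?thesis .
  qed
  also have "(\<integral>\<^sup>+Y. ?num Y * indicator ?Fc Y \<partial>?L)
      = (\<integral>\<^sup>+Y. \<integral>\<^sup>+x. ennreal (?p (simplex_chart K x) Y * ?g (simplex_chart K x))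
            * indicator B (simplex_chart K x) * indicator ?Fc Y \<partial>?P \<partial>?L)"
    unfolding num
  proof (intro nn_integral_cong nn_integral_multc[symmetric])
    fix Y assume "Y \<in> space ?L"
    from measurable_compose_Pair1[OF this meas_k]
    show "(\<lambda>x. ennreal (?p (simplex_chart K x) Y * ?g (simplex_chart K x)) * indicator B (simplex_chart K x)) \<in> borel_measurable ?P"
      by simp
  qed
  \<comment> \<open>After the exchange the inner integral is \<open>?g\<close> times the type II
    error at the parameter with chart coordinates \<open>x\<close>, so \<open>test\<close> applies
    pointwise.\<close>
  also have "\<dots> = (\<integral>\<^sup>+x. \<integral>\<^sup>+Y. ennreal (?p (simplex_chart K x) Y * ?g (simplex_chart K x))
            * indicator B (simplex_chart K x) * indicator ?Fc Y \<partial>?L \<partial>?P)"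
    by (rule LP.Fubini'[symmetric]) (use meas_k in \<open>simp add: case_prod_unfold\<close>)
  also have "\<dots> \<le> (\<integral>\<^sup>+x. ennreal \<epsilon> * (ennreal (?g (simplex_chart K x)) * indicator (prob_simplex K) (simplex_chart K x)) \<partial>?P)"
  proof (rule nn_integral_mono)
    fix x
    let ?\<beta> = "simplex_chart K x"
    show "(\<integral>\<^sup>+Y. ennreal (?p ?\<beta> Y * ?g ?\<beta>) * indicator B ?\<beta> * indicator ?Fc Y \<partial>?L)
        \<le> ennreal \<epsilon> * (ennreal (?g ?\<beta>) * indicator (prob_simplex K) ?\<beta>)"
    proof (cases "?\<beta> \<in> B")
      case True
      have "(\<integral>\<^sup>+Y. ennreal (?p ?\<beta> Y * ?g ?\<beta>) * indicator B ?\<beta> * indicator ?Fc Y \<partial>?L)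
          = (\<integral>\<^sup>+Y. ennreal (?g ?\<beta>) * (ennreal (?p ?\<beta> Y) * indicator ?Fc Y) \<partial>?L)"
        using True g0[OF True] std_gaussian_density_pos[of n "mat_vec K X ?\<beta>"]
        by (intro nn_integral_cong) (simp add: ennreal_mult less_imp_le mult_ac)
      also have "\<dots> = ennreal (?g ?\<beta>) * (\<integral>\<^sup>+Y. ennreal (?p ?\<beta> Y) * indicator ?Fc Y \<partial>?L)"
        by (rule nn_integral_cmult) measurable
      also have "(\<integral>\<^sup>+Y. ennreal (?p ?\<beta> Y) * indicator ?Fc Y \<partial>?L) = emeasure (std_gaussian n (mat_vec K X ?\<beta>)) ?Fc"
        unfolding std_gaussian_def by (rule emeasure_density[symmetric]) measurable
      also have "ennreal (?g ?\<beta>) * \<dots> \<le> ennreal (?g ?\<beta>) * ennreal \<epsilon>"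
        by (intro mult_left_mono test True) simp
      finally show ?thesis using True B(2) by (auto simp: mult.commute)
    qed simp
  qed
  also have "\<dots> = ennreal \<epsilon> * (\<integral>\<^sup>+x. ennreal (?g (simplex_chart K x)) * indicator (prob_simplex K) (simplex_chart K x) \<partial>?P)"
    using prob_simplex_measurable[of K]
    by (intro nn_integral_cmult measurable_compose[OF simplex_chart_measurable, of "\<lambda>\<beta>. ennreal (?g \<beta>) * indicator (prob_simplex K) \<beta>"])
       (simp add: sets_simplex_lborel)
  also have "(\<integral>\<^sup>+x. ennreal (?g (simplex_chart K x)) * indicator (prob_simplex K) (simplex_chart K x) \<partial>?P)
      = (\<integral>\<^sup>+\<beta>\<in>prob_simplex K. ennreal (?g \<beta>) \<partial>simplex_lborel K)"
    unfolding simplex_lborel_def using prob_simplex_measurable[of K]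
    by (intro nn_integral_distr[symmetric] simplex_chart_measurable) (simp add: sets_simplex_lborel)
  also have "\<dots> = 1" by (rule nn_integral_double_spike_dirichlet_density[OF K \<theta> \<rho>])
  also have "ennreal (1 / d) * (ennreal \<epsilon> * 1) = ennreal (\<epsilon> / d)"
    using d \<epsilon> by (simp add: ennreal_mult'[symmetric] del: ennreal_mult'')
  finally show ?thesis by (simp add: add_left_mono mult_left_mono)
qed

subsection \<open>The compatibility number and the test against the complement of a ball\<close>

lemma L2_set_sum_le:
  "L2_set (\<lambda>i. \<Sum>j\<in>J. f j i) A \<le> (\<Sum>j\<in>J. L2_set (f j) A)"
proof (cases "finite J")
  case True
  then show ?thesis
  proof induction
    case (insert j J)
    have "L2_set (\<lambda>i. f j i + (\<Sum>j\<in>J. f j i)) A \<le> L2_set (f j) A + L2_set (\<lambda>i. \<Sum>j\<in>J. f j i) A"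
      by (rule L2_set_triangle_ineq)
    with insert show ?case by simp
  qed (simp add: L2_set_def)
qed (simp add: L2_set_def)

lemma column_le_max_col_norm: "j < K \<Longrightarrow> L2_set (\<lambda>i. X i j) {..<n} \<le> max_col_norm n K X"
  unfolding max_col_norm_def by (rule Max_ge) auto

lemma max_col_norm_nonneg: "K > 0 \<Longrightarrow> max_col_norm n K X \<ge> 0"
  using column_le_max_col_norm[of 0 K X n] L2_set_nonneg order_trans by blast

lemma L2_set_mat_vec_le:
  "L2_set (mat_vec K X b) {..<n} \<le> max_col_norm n K X * l1_norm K b"
proof -
  have "L2_set (mat_vec K X b) {..<n} \<le> (\<Sum>j<K. L2_set (\<lambda>i. X i j * b j) {..<n})"
    unfolding mat_vec_def by (rule L2_set_sum_le)
  also have "\<dots> = (\<Sum>j<K. L2_set (\<lambda>i. X i j) {..<n} * \<bar>b j\<bar>)"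
    by (intro sum.cong refl)
      (simp add: L2_set_def power_mult_distrib sum_distrib_right[symmetric] real_sqrt_mult)
  also have "\<dots> \<le> (\<Sum>j<K. max_col_norm n K X * \<bar>b j\<bar>)"
    by (intro sum_mono mult_right_mono column_le_max_col_norm) auto
  finally show ?thesis by (simp add: l1_norm_def sum_distrib_left)
qed

lemma compat_number_le:
  assumes "b \<in> {..<K} \<rightarrow>\<^sub>E UNIV" "\<exists>j<K. b j \<noteq> 0" "l1_norm K b \<le> 2"
  shows "compat_number n K X s
    \<le> L2_set (mat_vec K X b) {..<n} * sqrt (real s) / (max_col_norm n K X * l1_norm K b)"
  unfolding compat_number_def
proof (rule cInf_lower)
  have "K > 0" using assms(2) by auto
  then show "bdd_below {L2_set (mat_vec K X \<beta>) {..<n} * sqrt (real s) / (max_col_norm n K X * l1_norm K \<beta>) | \<beta>.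
            \<beta> \<in> {..<K} \<rightarrow>\<^sub>E UNIV \<and> (\<exists>j<K. \<beta> j \<noteq> 0) \<and> l1_norm K \<beta> \<le> 2}"
    by (intro bdd_belowI[of _ 0], clarify)
       (intro divide_nonneg_nonneg mult_nonneg_nonneg max_col_norm_nonneg L2_set_nonneg, simp_all add: l1_norm_def sum_nonneg)
qed (use assms in auto)

lemma max_col_norm_pos_if_compat_number_pos:
  assumes "K > 0" "compat_number n K X s > 0"
  shows "max_col_norm n K X > 0"
proof (rule ccontr)
  assume "\<not> ?thesis"
  then have 0: "max_col_norm n K X = 0" using max_col_norm_nonneg[OF assms(1), of n X] by simp
  \<comment> \<open>A unit vector is admissible in the infimum. When the maximal column norm is 0
    its quotient has denominator 0, hence value 0.\<close>
  let ?b = "\<lambda>i\<in>{..<K}. if i = 0 then 1 else 0 :: real"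
  have "l1_norm K ?b = (\<Sum>i<K. if i = 0 then 1 else 0)"
    unfolding l1_norm_def by (intro sum.cong) auto
  then have "l1_norm K ?b = 1" using assms(1) by simp
  then have "compat_number n K X s \<le> 0"
    using compat_number_le[of ?b K n X s] assms(1) 0 by auto
  with assms(2) show False by simp
qed

text \<open>The coordinate differences of two simplex vectors sum to 0, so the sum over
  \<open>T\<close> is the negative of the sum over the complement. Doubling it therefore counts
  every coordinate once with some sign. Each \<open>T\<close> thus gives a linear functional below
  the distance.\<close>

lemma l1_norm_diff_ge:
  assumes "\<beta> \<in> prob_simplex K" "\<beta>' \<in> prob_simplex K" "T \<subseteq> {..<K}"
  shows "2 * (\<Sum>i\<in>T. \<beta>' i - \<beta> i) \<le> l1_norm K (\<lambda>j. \<beta> j - \<beta>' j)"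
proof -
  have *: "(\<Sum>i<K. h i) = (\<Sum>i\<in>T. h i) + (\<Sum>i\<in>{..<K} - T. h i)" for h :: "nat \<Rightarrow> real"
    using assms(3) by (subst sum.subset_diff[of T]) auto
  have "(\<Sum>i<K. \<beta>' i - \<beta> i) = 0" using assms by (simp add: prob_simplex_def sum_subtractf)
  then have "2 * (\<Sum>i\<in>T. \<beta>' i - \<beta> i) = (\<Sum>i\<in>T. \<beta>' i - \<beta> i) + (\<Sum>i\<in>{..<K} - T. - (\<beta>' i - \<beta> i))"
    unfolding * sum_negf by simp
  also have "\<dots> \<le> (\<Sum>i\<in>T. \<bar>\<beta> i - \<beta>' i\<bar>) + (\<Sum>i\<in>{..<K} - T. \<bar>\<beta> i - \<beta>' i\<bar>)"
    by (intro add_mono sum_mono) auto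
  finally show ?thesis by (simp add: l1_norm_def *)
qed

text \<open>The bound above is attained by the set where \<open>\<beta>\<close> lies below
  \<open>\<beta>'\<close>, since there every sign is the right one. The distance is thus a maximum
  of linear functionals, and the complement of a ball is a union of convex pieces.\<close>

lemma l1_norm_diff_eq:
  assumes "\<beta> \<in> prob_simplex K" "\<beta>' \<in> prob_simplex K"
  shows "l1_norm K (\<lambda>j. \<beta> j - \<beta>' j) = 2 * (\<Sum>i\<in>{i. i < K \<and> \<beta> i < \<beta>' i}. \<beta>' i - \<beta> i)"
proof -
  let ?T = "{i. i < K \<and> \<beta> i < \<beta>' i}"
  have *: "(\<Sum>i<K. h i) = (\<Sum>i\<in>?T. h i) + (\<Sum>i\<in>{..<K} - ?T. h i)" for h :: "nat \<Rightarrow> real"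
    by (subst sum.subset_diff[of ?T]) auto
  have "(\<Sum>i<K. \<beta>' i - \<beta> i) = 0" using assms by (simp add: prob_simplex_def sum_subtractf)
  then have "2 * (\<Sum>i\<in>?T. \<beta>' i - \<beta> i) = (\<Sum>i\<in>?T. \<beta>' i - \<beta> i) + (\<Sum>i\<in>{..<K} - ?T. - (\<beta>' i - \<beta> i))"
    unfolding * sum_negf by simp
  also have "\<dots> = (\<Sum>i\<in>?T. \<bar>\<beta> i - \<beta>' i\<bar>) + (\<Sum>i\<in>{..<K} - ?T. \<bar>\<beta> i - \<beta>' i\<bar>)"
    by (intro arg_cong2[where f = "(+)"] sum.cong) auto
  finally show ?thesis by (simp add: l1_norm_def *)
qed

lemma l1_norm_simplex_diff_le_2:
  assumes "\<beta> \<in> prob_simplex K" "\<beta>' \<in> prob_simplex K"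
  shows "l1_norm K (\<lambda>j. \<beta> j - \<beta>' j) \<le> 2"
proof -
  have "(\<Sum>j<K. \<bar>\<beta> j - \<beta>' j\<bar>) \<le> (\<Sum>j<K. \<beta> j + \<beta>' j)"
    using assms by (intro sum_mono) (auto simp: prob_simplex_def abs_le_iff)
  then show ?thesis using assms by (simp add: l1_norm_def prob_simplex_def sum.distrib)
qed

text \<open>Differences of simplex vectors have norm at most 2 and so are admissible in the infimum.
  The inequality is multiplied out to cover the zero difference as well.\<close>

lemma compat_number_simplex_diff:
  assumes "\<beta> \<in> prob_simplex K" "\<beta>' \<in> prob_simplex K" "compat_number n K X s > 0"
  shows "compat_number n K X s * max_col_norm n K X * l1_norm K (\<lambda>j. \<beta> j - \<beta>' j)
    \<le> L2_set (\<lambda>i. mat_vec K X \<beta> i - mat_vec K X \<beta>' i) {..<n} * sqrt (real s)"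
proof (cases "l1_norm K (\<lambda>j. \<beta> j - \<beta>' j) = 0")
  case False
  \<comment> \<open>The infimum ranges over vectors that are \<open>undefined\<close> beyond
    \<open>K\<close>, so the difference has to be restricted.\<close>
  let ?b = "\<lambda>j\<in>{..<K}. \<beta> j - \<beta>' j"
  have l1: "l1_norm K ?b = l1_norm K (\<lambda>j. \<beta> j - \<beta>' j)"
    unfolding l1_norm_def by (intro sum.cong) auto
  have mv: "mat_vec K X ?b = (\<lambda>i. mat_vec K X \<beta> i - mat_vec K X \<beta>' i)"
    unfolding mat_vec_def sum_subtractf[symmetric] by (intro ext sum.cong) (auto simp: algebra_simps)
  have ex: "\<exists>j<K. ?b j \<noteq> 0"
  proof (rule ccontr)
    assume "\<not> ?thesis"
    then have "l1_norm K ?b = 0" unfolding l1_norm_def by (intro sum.neutral) auto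
    with False l1 show False by simp
  qed
  then have "K > 0" by auto
  then have x: "max_col_norm n K X > 0" using assms(3) by (rule max_col_norm_pos_if_compat_number_pos)
  have "l1_norm K ?b \<ge> 0" by (simp add: l1_norm_def sum_nonneg)
  then have pos: "max_col_norm n K X * l1_norm K ?b > 0" using False l1 x by simp
  have "compat_number n K X s
      \<le> L2_set (mat_vec K X ?b) {..<n} * sqrt (real s) / (max_col_norm n K X * l1_norm K ?b)"
    by (rule compat_number_le) (use ex l1 l1_norm_simplex_diff_le_2[OF assms(1,2)] in auto)
  then have "compat_number n K X s * (max_col_norm n K X * l1_norm K ?b)
      \<le> L2_set (mat_vec K X ?b) {..<n} * sqrt (real s)"
    using pos by (simp only: pos_le_divide_eq)
  then show ?thesis by (simp only: l1 mv mult.assoc)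
qed (simp add: L2_set_nonneg)

lemma mat_vec_convex:
  "(\<lambda>i. mat_vec K X \<beta> i + t * (mat_vec K X \<beta>' i - mat_vec K X \<beta> i))
     = mat_vec K X (\<lambda>j\<in>{..<K}. \<beta> j + t * (\<beta>' j - \<beta> j))"
  unfolding mat_vec_def sum_subtractf[symmetric] sum_distrib_left sum.distrib[symmetric]
  by (intro ext sum.cong) (auto simp: algebra_simps)

lemma prob_simplex_convex:
  assumes "\<beta> \<in> prob_simplex K" "\<beta>' \<in> prob_simplex K" "0 \<le> t" "t \<le> 1"
  shows "(\<lambda>j\<in>{..<K}. \<beta> j + t * (\<beta>' j - \<beta> j)) \<in> prob_simplex K"
proof -
  have "\<beta> j + t * (\<beta>' j - \<beta> j) \<ge> 0" if "j < K" for j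
  proof -
    have "(1 - t) * \<beta> j + t * \<beta>' j \<ge> 0"
      using assms that by (intro add_nonneg_nonneg mult_nonneg_nonneg) (auto simp: prob_simplex_def)
    then show ?thesis by (simp add: algebra_simps)
  qed
  moreover have "(\<Sum>j<K. \<beta> j + t * (\<beta>' j - \<beta> j)) = 1"
    using assms by (simp add: prob_simplex_def sum.distrib sum_distrib_left[symmetric] sum_subtractf)
  ultimately show ?thesis by (simp add: prob_simplex_def)
qed

text \<open>One convex test for each subset \<open>T\<close> of the support of
  \<open>\<beta>'\<close>, rejecting if any of them does. Type I errors add up over the subsets. For
  the type II error at a given \<open>\<beta>\<close>, the one test whose \<open>T\<close> attains
  the distance suffices. Compatibility turns the radius \<open>r\<close> into the squared distance
  \<open>\<delta>\<close> between the images under the design matrix.\<close>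

lemma l1_complement_test:
  fixes r :: real
  assumes \<beta>': "\<beta>' \<in> prob_simplex K" and \<Phi>: "compat_number n K X s > 0" and K: "K > 0" and s: "s > 0"
    and r: "r > 0"
    and \<delta>: "\<delta> = (compat_number n K X s * max_col_norm n K X * r)\<^sup>2 / real s"
  obtains F where "F \<in> sets (PiM {..<n} (\<lambda>_. lborel :: real measure))"
    "emeasure (std_gaussian n (mat_vec K X \<beta>')) F
      \<le> ennreal (2 ^ card {i. i < K \<and> \<beta>' i \<noteq> 0} * exp (- \<delta> / 8))"
    "\<And>\<beta>. \<beta> \<in> prob_simplex K \<Longrightarrow> l1_norm K (\<lambda>j. \<beta> j - \<beta>' j) > r \<Longrightarrow>
      emeasure (std_gaussian n (mat_vec K X \<beta>)) (space (PiM {..<n} (\<lambda>_. lborel :: real measure)) - F)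
        \<le> ennreal (exp (- \<delta> / 32))"
proof -
  let ?L = "PiM {..<n} (\<lambda>_. lborel :: real measure)"
  let ?S = "{i. i < K \<and> \<beta>' i \<noteq> 0}"
  let ?x = "max_col_norm n K X" and ?\<Phi> = "compat_number n K X s"
  define H where "H T = {\<beta> \<in> prob_simplex K. (\<Sum>i\<in>T. \<beta>' i - \<beta> i) > r / 2}" for T
  have x: "?x > 0" by (rule max_col_norm_pos_if_compat_number_pos[OF K \<Phi>])
  have \<delta>0: "\<delta> > 0" unfolding \<delta> using x \<Phi> r s by simp
  define P where "P T F \<longleftrightarrow> F \<in> sets ?L
      \<and> emeasure (std_gaussian n (mat_vec K X \<beta>')) F \<le> ennreal (exp (- \<delta> / 8))
      \<and> (\<forall>\<beta>\<in>H T. emeasure (std_gaussian n (mat_vec K X \<beta>)) (space ?L - F) \<le> ennreal (exp (- \<delta> / 32)))"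
    for T F
  have ex: "\<exists>F. P T F" if T: "T \<subseteq> ?S" for T
  proof (rule std_gaussian_convex_test[where C = "mat_vec K X ` H T" and ?\<mu>0.0 = "mat_vec K X \<beta>'"
        and \<delta> = \<delta> and n = n and E = "(?x * 2)\<^sup>2"])
    show "\<delta> > 0" by (rule \<delta>0)
  next
    fix u v and t :: real
    assume uv: "u \<in> mat_vec K X ` H T" "v \<in> mat_vec K X ` H T" and t: "0 \<le> t" "t \<le> 1"
    then obtain \<beta>1 \<beta>2 where b: "\<beta>1 \<in> H T" "\<beta>2 \<in> H T" "u = mat_vec K X \<beta>1" "v = mat_vec K X \<beta>2" by auto
    let ?b = "\<lambda>j\<in>{..<K}. \<beta>1 j + t * (\<beta>2 j - \<beta>1 j)"
    define p q where "p = (\<Sum>i\<in>T. \<beta>' i - \<beta>1 i)" and "q = (\<Sum>i\<in>T. \<beta>' i - \<beta>2 i)"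
    have pq: "r / 2 < p" "r / 2 < q" using b by (auto simp: H_def p_def q_def)
    have "(\<Sum>i\<in>T. \<beta>' i - ?b i) = (\<Sum>i\<in>T. (1 - t) * (\<beta>' i - \<beta>1 i) + t * (\<beta>' i - \<beta>2 i))"
      using T by (intro sum.cong) (auto simp: algebra_simps)
    also have "\<dots> = (1 - t) * p + t * q"
      by (simp add: p_def q_def sum.distrib sum_distrib_left)
    also have "\<dots> > r / 2"
    proof -
      have "(1 - t) * p + t * q \<ge> (1 - t) * min p q + t * min p q"
        using t by (intro add_mono mult_left_mono) auto
      then show ?thesis using pq by (simp add: algebra_simps)
    qed
    finally have "?b \<in> H T" using b t by (simp add: H_def prob_simplex_convex)
    then show "(\<lambda>i. u i + t * (v i - u i)) \<in> mat_vec K X ` H T"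
      by (auto simp only: b mat_vec_convex)
  next
    fix v assume "v \<in> mat_vec K X ` H T"
    then obtain \<beta> where \<beta>: "\<beta> \<in> prob_simplex K" "(\<Sum>i\<in>T. \<beta>' i - \<beta> i) > r / 2" "v = mat_vec K X \<beta>"
      by (auto simp: H_def)
    have "2 * (\<Sum>i\<in>T. \<beta>' i - \<beta> i) \<le> l1_norm K (\<lambda>j. \<beta> j - \<beta>' j)"
      by (rule l1_norm_diff_ge) (use \<beta> \<beta>' T in auto)
    \<comment> \<open>Membership in \<open>H T\<close> makes the distance from
      \<open>\<beta>'\<close> exceed \<open>r\<close>, so compatibility separates the
      images.\<close>
    then have "?\<Phi> * ?x * r \<le> ?\<Phi> * ?x * l1_norm K (\<lambda>j. \<beta> j - \<beta>' j)"
      using \<beta>(2) x \<Phi> by (intro mult_left_mono) auto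
    also have "\<dots> \<le> L2_set (\<lambda>i. v i - mat_vec K X \<beta>' i) {..<n} * sqrt (real s)"
      unfolding \<beta>(3) by (rule compat_number_simplex_diff[OF \<beta>(1) \<beta>' \<Phi>])
    finally have "(?\<Phi> * ?x * r)\<^sup>2 \<le> (L2_set (\<lambda>i. v i - mat_vec K X \<beta>' i) {..<n} * sqrt (real s))\<^sup>2"
      using x \<Phi> r by (intro power_mono) auto
    also have "\<dots> = (\<Sum>i<n. (v i - mat_vec K X \<beta>' i)\<^sup>2) * real s"
      by (simp add: power_mult_distrib L2_set_def sum_nonneg)
    finally show "\<delta> \<le> (\<Sum>i<n. (v i - mat_vec K X \<beta>' i)\<^sup>2)"
      unfolding \<delta> using s by (simp add: pos_divide_le_eq)
  next
    fix u v assume uv: "u \<in> mat_vec K X ` H T" "v \<in> mat_vec K X ` H T"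
    then obtain \<beta>1 \<beta>2 where b: "\<beta>1 \<in> prob_simplex K" "\<beta>2 \<in> prob_simplex K" "u = mat_vec K X \<beta>1" "v = mat_vec K X \<beta>2"
      by (auto simp: H_def)
    have "(\<lambda>i. v i - u i) = mat_vec K X (\<lambda>j. \<beta>2 j - \<beta>1 j)"
      by (simp add: b fun_eq_iff mat_vec_def right_diff_distrib sum_subtractf)
    then have "L2_set (\<lambda>i. v i - u i) {..<n} \<le> ?x * l1_norm K (\<lambda>j. \<beta>2 j - \<beta>1 j)"
      using L2_set_mat_vec_le[of K X _ n] by simp
    also have "\<dots> \<le> ?x * 2"
      using x by (intro mult_left_mono l1_norm_simplex_diff_le_2 b) auto
    finally have "(L2_set (\<lambda>i. v i - u i) {..<n})\<^sup>2 \<le> (?x * 2)\<^sup>2"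
      by (intro power_mono) (auto simp: L2_set_nonneg)
    then show "(\<Sum>i<n. (v i - u i)\<^sup>2) \<le> (?x * 2)\<^sup>2" by (simp add: L2_set_def sum_nonneg)
  qed (auto simp: P_def)
  obtain F where "\<And>T. T \<subseteq> ?S \<Longrightarrow> P T (F T)" using ex by metis
  then have F: "\<And>T. T \<subseteq> ?S \<Longrightarrow> F T \<in> sets ?L"
    "\<And>T. T \<subseteq> ?S \<Longrightarrow> emeasure (std_gaussian n (mat_vec K X \<beta>')) (F T) \<le> ennreal (exp (- \<delta> / 8))"
    "\<And>T \<beta>. T \<subseteq> ?S \<Longrightarrow> \<beta> \<in> H T \<Longrightarrow>
      emeasure (std_gaussian n (mat_vec K X \<beta>)) (space ?L - F T) \<le> ennreal (exp (- \<delta> / 32))"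
    unfolding P_def by blast+
  show thesis
  proof (rule that[of "\<Union>T\<in>Pow ?S. F T"])
    show UF: "(\<Union>T\<in>Pow ?S. F T) \<in> sets ?L" using F(1) by (intro sets.finite_UN) auto
    have "emeasure (std_gaussian n (mat_vec K X \<beta>')) (\<Union>T\<in>Pow ?S. F T)
        \<le> (\<Sum>T\<in>Pow ?S. emeasure (std_gaussian n (mat_vec K X \<beta>')) (F T))"
      using F(1) by (intro emeasure_subadditive_finite) (auto simp: sets_std_gaussian)
    also have "\<dots> \<le> (\<Sum>T\<in>Pow ?S. ennreal (exp (- \<delta> / 8)))"
      using F(2) by (intro sum_mono) auto
    also have "\<dots> = ennreal (2 ^ card ?S * exp (- \<delta> / 8))"
      by (simp add: card_Pow ennreal_mult' ennreal_power[symmetric] del: ennreal_mult'')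
    finally show "emeasure (std_gaussian n (mat_vec K X \<beta>')) (\<Union>T\<in>Pow ?S. F T)
        \<le> ennreal (2 ^ card ?S * exp (- \<delta> / 8))" .
    fix \<beta> assume \<beta>: "\<beta> \<in> prob_simplex K" "l1_norm K (\<lambda>j. \<beta> j - \<beta>' j) > r"
    let ?T = "{i. i < K \<and> \<beta> i < \<beta>' i}"
    \<comment> \<open>Coordinates of \<open>\<beta>\<close> are nonnegative, so
      \<open>\<beta>'\<close> is positive wherever it exceeds \<open>\<beta>\<close>. Hence subsets
      of the support are enough.\<close>
    have T: "?T \<subseteq> ?S" using \<beta>(1) by (auto simp: prob_simplex_def)
    have "\<beta> \<in> H ?T" using \<beta> l1_norm_diff_eq[OF \<beta>(1) \<beta>'] by (simp add: H_def)
    then have "emeasure (std_gaussian n (mat_vec K X \<beta>)) (space ?L - F ?T) \<le> ennreal (exp (- \<delta> / 32))"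
      by (rule F(3)[OF T])
    moreover have "emeasure (std_gaussian n (mat_vec K X \<beta>)) (space ?L - (\<Union>T\<in>Pow ?S. F T))
        \<le> emeasure (std_gaussian n (mat_vec K X \<beta>)) (space ?L - F ?T)"
    proof (rule emeasure_mono)
      show "space ?L - (\<Union>T\<in>Pow ?S. F T) \<subseteq> space ?L - F ?T" using T by blast
      show "space ?L - F ?T \<in> sets (std_gaussian n (mat_vec K X \<beta>))"
        unfolding sets_std_gaussian by (intro sets.compl_sets F(1) T)
    qed
    ultimately show "emeasure (std_gaussian n (mat_vec K X \<beta>)) (space ?L - (\<Union>T\<in>Pow ?S. F T))
        \<le> ennreal (exp (- \<delta> / 32))" by (rule order.trans[rotated])
  qed
qed

subsection \<open>The evidence lower bound\<close>

text \<open>A union bound over \<open>K\<close> columns and two signs. The level \<open>t\<close>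
  makes each one-sided tail at most \<open>1 / (real K)\<^sup>2\<close>.\<close>

lemma noise_correlation_event:
  fixes \<mu> :: "nat \<Rightarrow> real"
  assumes x: "max_col_norm n K X > 0" and K: "K > 1"
  defines "t \<equiv> 2 * max_col_norm n K X * sqrt (ln (real K))"
  defines "G \<equiv> {y \<in> space (PiM {..<n} (\<lambda>_. lborel :: real measure)).
                 \<forall>j\<in>{..<K}. \<bar>\<Sum>i<n. X i j * (y i - \<mu> i)\<bar> \<le> t}"
  shows "G \<in> sets (PiM {..<n} (\<lambda>_. lborel :: real measure))"
    and "emeasure (std_gaussian n \<mu>) (space (PiM {..<n} (\<lambda>_. lborel :: real measure)) - G)
          \<le> ennreal (2 / real K)"
proof -
  let ?L = "PiM {..<n} (\<lambda>_. lborel :: real measure)"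
  let ?x = "max_col_norm n K X"
  show "G \<in> sets ?L" unfolding G_def by measurable
  have l: "ln (real K) > 0" using K by simp
  \<comment> \<open>The optimal tilt for level \<open>t\<close>: both \<open>c * t\<close> and the
    bound for the squared norm of the tilt vector equal \<open>4 * ln (real K)\<close>, so the
    Chernoff exponent is at most \<open>2 * ln (real K) - 4 * ln (real K)\<close>.\<close>
  define c where "c = 2 * sqrt (ln (real K)) / ?x"
  have c: "c > 0" using x l by (simp add: c_def)
  have ct: "c * t = 4 * ln (real K)" using x l by (simp add: c_def t_def)
  define A where "A \<sigma> j = {y \<in> space ?L. 4 * ln (real K) \<le> (\<Sum>i<n. (\<sigma> * c * X i j) * (y i - \<mu> i))}"
    for \<sigma> :: real and j
  have A: "emeasure (std_gaussian n \<mu>) (A \<sigma> j) \<le> ennreal (1 / (real K)\<^sup>2)" if "j < K" "\<sigma>\<^sup>2 = 1" for \<sigma> j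
  proof -
    have "(\<Sum>i<n. (\<sigma> * c * X i j)\<^sup>2) = c\<^sup>2 * (L2_set (\<lambda>i. X i j) {..<n})\<^sup>2"
      using that by (simp add: power_mult_distrib sum_distrib_left[symmetric] L2_set_def sum_nonneg)
    also have "\<dots> \<le> c\<^sup>2 * ?x\<^sup>2"
      using that by (intro mult_left_mono power_mono column_le_max_col_norm) (auto simp: L2_set_nonneg)
    also have "\<dots> = 4 * ln (real K)" using x l by (simp add: c_def power_mult_distrib power_divide)
    finally have "(\<Sum>i<n. (\<sigma> * c * X i j)\<^sup>2) / 2 - 4 * ln (real K) \<le> - (2 * ln (real K))" by simp
    then have "exp ((\<Sum>i<n. (\<sigma> * c * X i j)\<^sup>2) / 2 - 4 * ln (real K)) \<le> exp (- (2 * ln (real K)))"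
      by simp
    also have "\<dots> = 1 / (real K)\<^sup>2"
      using K exp_of_nat_mult[of 2 "ln (real K)"] by (simp add: exp_minus inverse_eq_divide)
    finally show ?thesis unfolding A_def
      by (intro order.trans[OF std_gaussian_Chernoff] ennreal_leI)
  qed
  have "space ?L - G \<subseteq> (\<Union>j\<in>{..<K}. A 1 j) \<union> (\<Union>j\<in>{..<K}. A (-1) j)"
  proof
    fix y assume y: "y \<in> space ?L - G"
    then obtain j where j: "j < K" "\<bar>\<Sum>i<n. X i j * (y i - \<mu> i)\<bar> > t"
      by (auto simp: G_def not_le)
    define S where "S = (\<Sum>i<n. X i j * (y i - \<mu> i))"
    have S: "(\<Sum>i<n. (\<sigma> * c * X i j) * (y i - \<mu> i)) = \<sigma> * c * S" for \<sigma>
      by (simp add: S_def sum_distrib_left mult_ac)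
    have "c * t \<le> c * \<bar>S\<bar>" using j(2) c by (intro mult_left_mono) (auto simp: S_def)
    then have "c * t \<le> 1 * c * S \<or> c * t \<le> (-1) * c * S" by (cases "S \<ge> 0") auto
    moreover have "y \<in> A \<sigma> j" if "c * t \<le> \<sigma> * c * S" for \<sigma>
      using y that S[of \<sigma>] unfolding A_def ct by (simp only: mem_Collect_eq) blast
    ultimately have "y \<in> A 1 j \<or> y \<in> A (-1) j" by blast
    then show "y \<in> (\<Union>j\<in>{..<K}. A 1 j) \<union> (\<Union>j\<in>{..<K}. A (-1) j)" using j(1) by auto
  qed
  moreover have [measurable]: "A \<sigma> j \<in> sets (std_gaussian n \<mu>)" for \<sigma> j
    unfolding A_def sets_std_gaussian by measurable
  ultimately have "emeasure (std_gaussian n \<mu>) (space ?L - G)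
      \<le> emeasure (std_gaussian n \<mu>) ((\<Union>j\<in>{..<K}. A 1 j) \<union> (\<Union>j\<in>{..<K}. A (-1) j))"
    by (intro emeasure_mono) auto
  also have "\<dots> \<le> emeasure (std_gaussian n \<mu>) (\<Union>j\<in>{..<K}. A 1 j) + emeasure (std_gaussian n \<mu>) (\<Union>j\<in>{..<K}. A (-1) j)"
    by (intro emeasure_subadditive) auto
  also have "\<dots> \<le> (\<Sum>j<K. emeasure (std_gaussian n \<mu>) (A 1 j)) + (\<Sum>j<K. emeasure (std_gaussian n \<mu>) (A (-1) j))"
    by (intro add_mono emeasure_subadditive_finite) auto
  also have "\<dots> \<le> (\<Sum>j<K. ennreal (1 / (real K)\<^sup>2)) + (\<Sum>j<K. ennreal (1 / (real K)\<^sup>2))"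
    by (intro add_mono sum_mono A) auto
  also have "\<dots> = ennreal (2 / real K)"
    using K by (simp add: ennreal_of_nat_eq_real_of_nat ennreal_mult'[symmetric] ennreal_plus[symmetric]
        power2_eq_square del: ennreal_plus ennreal_mult'')
  finally show "emeasure (std_gaussian n \<mu>) (space ?L - G) \<le> ennreal (2 / real K)" .
qed

lemma one_minus_ge_exp:
  fixes u :: real
  assumes "0 \<le> u" "u \<le> 1 / 2"
  shows "exp (- 2 * u) \<le> 1 - u"
proof -
  have "1 + 2 * u \<le> exp (2 * u)" by (rule exp_ge_add_one_self)
  moreover have "1 \<le> (1 + 2 * u) * (1 - u)"
  proof -
    have "u * (1 - 2 * u) \<ge> 0" using assms by (intro mult_nonneg_nonneg) auto
    then show ?thesis by (simp add: algebra_simps)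
  qed
  moreover have "(1 + 2 * u) * (1 - u) \<le> exp (2 * u) * (1 - u)"
    using assms calculation(1) by (intro mult_right_mono) auto
  ultimately have "1 \<le> exp (2 * u) * (1 - u)" by linarith
  then have "exp (- 2 * u) * 1 \<le> exp (- 2 * u) * (exp (2 * u) * (1 - u))"
    by (intro mult_left_mono) auto
  also have "\<dots> = 1 - u" by (simp add: mult.assoc[symmetric] mult_exp_exp)
  finally show ?thesis by simp
qed

text \<open>Once \<open>ln (real K) \<ge> 2 - ln c\<close>, the lower bound on
  \<open>\<theta>\<close> gives \<open>\<theta> \<ge> exp 2 / (real K)\<^sup>2\<close>. The surplus
  \<open>exp (2 * real s)\<close> in \<open>\<theta> ^ s\<close> pays for the other factor, which is
  at least \<open>exp (- 2 * real s)\<close> because \<open>\<theta>\<close> is at most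
  \<open>real s / real K\<close>, itself at most 1/2.\<close>

lemma spike_weight_ge:
  assumes K: "K > 0" and s: "s > 0" "2 * s \<le> K" and c: "c > 0"
    and \<theta>: "c / real K \<le> \<theta>" "\<theta> \<le> real s / real K" and large: "2 - ln c \<le> ln (real K)"
  shows "exp (- 2 * real s * ln (real K)) \<le> \<theta> ^ s * (1 - \<theta>) ^ (K - s)"
proof -
  have half: "real s / real K \<le> 1 / 2" using K s by (simp add: divide_simps)
  have \<theta>0: "0 < \<theta>" using \<theta>(1) c K by (meson divide_pos_pos less_le_trans of_nat_0_less_iff)
  have "exp (2 - 2 * ln (real K)) \<le> exp (ln c - ln (real K))" using large by simp
  also have "\<dots> = c / real K" using c K by (simp add: exp_diff)
  also have "\<dots> \<le> \<theta>" by (rule \<theta>)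
  finally have "exp (2 - 2 * ln (real K)) ^ s \<le> \<theta> ^ s" by (intro power_mono) auto
  then have 1: "exp (real s * (2 - 2 * ln (real K))) \<le> \<theta> ^ s" by (simp add: exp_of_nat_mult)
  have "exp (- 2 * real s) \<le> exp (- 2 * (real s / real K)) ^ (K - s)"
  proof -
    have "real (K - s) * (2 * (real s / real K)) \<le> real K * (2 * (real s / real K))"
      by (intro mult_right_mono) auto
    then have "- 2 * real s \<le> real (K - s) * (- 2 * (real s / real K))" using K by simp
    then have "exp (- 2 * real s) \<le> exp (real (K - s) * (- 2 * (real s / real K)))"
      by (simp only: exp_le_cancel_iff)
    then show ?thesis by (simp only: exp_of_nat_mult)
  qed
  also have "\<dots> \<le> exp (- 2 * \<theta>) ^ (K - s)" using \<theta> by (intro power_mono) auto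
  also have "\<dots> \<le> (1 - \<theta>) ^ (K - s)"
    using \<theta>0 order.trans[OF \<theta>(2) half] by (intro power_mono one_minus_ge_exp) auto
  finally have "exp (real s * (2 - 2 * ln (real K))) * exp (- 2 * real s) \<le> \<theta> ^ s * (1 - \<theta>) ^ (K - s)"
    using 1 \<theta>0 by (intro mult_mono) auto
  then show ?thesis by (simp add: mult_exp_exp algebra_simps)
qed

text \<open>In the log likelihood ratio the linear term pairs \<open>\<beta> - \<beta>'\<close> with
  the correlations of noise and columns, so Hoelder's inequality bounds it by \<open>h * t\<close>.
  The quadratic term is bounded through the maximal column norm.\<close>

lemma std_gaussian_density_mat_vec_ge:
  assumes corr: "\<And>j. j < K \<Longrightarrow> \<bar>\<Sum>i<n. X i j * (Y i - mat_vec K X \<beta>' i)\<bar> \<le> t"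
    and l1: "l1_norm K (\<lambda>j. \<beta> j - \<beta>' j) \<le> h" and t: "t \<ge> 0" and K: "K > 0"
  shows "std_gaussian_density n (mat_vec K X \<beta>') Y * exp (- (h * t) - (max_col_norm n K X * h)\<^sup>2 / 2)
    \<le> std_gaussian_density n (mat_vec K X \<beta>) Y"
proof -
  define v where "v i = mat_vec K X (\<lambda>j. \<beta> j - \<beta>' j) i" for i
  have shift: "mat_vec K X \<beta> = (\<lambda>i. mat_vec K X \<beta>' i + v i)"
    by (simp add: fun_eq_iff v_def mat_vec_def right_diff_distrib sum_subtractf)
  have h0: "h \<ge> 0" using l1 by (rule order.trans[rotated]) (simp add: l1_norm_def sum_nonneg)
  have x0: "max_col_norm n K X \<ge> 0" by (rule max_col_norm_nonneg[OF K])
  have "(\<Sum>i<n. v i * (Y i - mat_vec K X \<beta>' i))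
      = (\<Sum>i<n. \<Sum>j<K. (\<beta> j - \<beta>' j) * (X i j * (Y i - mat_vec K X \<beta>' i)))"
    unfolding v_def mat_vec_def[of _ _ "\<lambda>j. \<beta> j - \<beta>' j"] sum_distrib_right
    by (intro sum.cong refl) simp
  also have "\<dots> = (\<Sum>j<K. (\<beta> j - \<beta>' j) * (\<Sum>i<n. X i j * (Y i - mat_vec K X \<beta>' i)))"
    by (subst sum.swap) (simp add: sum_distrib_left)
  finally have "\<bar>\<Sum>i<n. v i * (Y i - mat_vec K X \<beta>' i)\<bar>
      \<le> (\<Sum>j<K. \<bar>(\<beta> j - \<beta>' j) * (\<Sum>i<n. X i j * (Y i - mat_vec K X \<beta>' i))\<bar>)"
    by simp
  also have "\<dots> \<le> (\<Sum>j<K. \<bar>\<beta> j - \<beta>' j\<bar> * t)"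
    using corr by (intro sum_mono) (auto simp: abs_mult intro!: mult_left_mono)
  also have "\<dots> = l1_norm K (\<lambda>j. \<beta> j - \<beta>' j) * t" by (simp add: l1_norm_def sum_distrib_right)
  also have "\<dots> \<le> h * t" using l1 t by (rule mult_right_mono)
  finally have 1: "- (h * t) \<le> (\<Sum>i<n. v i * (Y i - mat_vec K X \<beta>' i))" by simp
  have "L2_set v {..<n} \<le> max_col_norm n K X * l1_norm K (\<lambda>j. \<beta> j - \<beta>' j)"
    unfolding v_def by (rule L2_set_mat_vec_le)
  also have "\<dots> \<le> max_col_norm n K X * h" using l1 x0 by (rule mult_left_mono)
  finally have "(L2_set v {..<n})\<^sup>2 \<le> (max_col_norm n K X * h)\<^sup>2"
    by (intro power_mono) (auto simp: L2_set_nonneg)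
  then have 2: "(\<Sum>i<n. (v i)\<^sup>2) \<le> (max_col_norm n K X * h)\<^sup>2" by (simp add: L2_set_def sum_nonneg)
  have "exp (- (h * t) - (max_col_norm n K X * h)\<^sup>2 / 2)
      \<le> exp ((\<Sum>i<n. v i * (Y i - mat_vec K X \<beta>' i)) - (\<Sum>i<n. (v i)\<^sup>2) / 2)"
    using 1 2 by simp
  then show ?thesis unfolding shift std_gaussian_density_shift
    using std_gaussian_density_pos[of n "mat_vec K X \<beta>'" Y] by (intro mult_left_mono) auto
qed

text \<open>The distance is twice a sum over a subset of the support, so Cauchy-Schwarz over at most
  \<open>s\<close> coordinates bounds it by the deviation on the support. The common total mass 1
  takes care of the coordinates off the support.\<close>

lemma structured_l1_le:
  assumes \<beta>: "\<beta> \<in> prob_simplex K" and \<beta>': "\<beta>' \<in> structured_simplex s K" and s: "s > 0" and \<rho>: "\<rho> > 0"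
    and Q: "(\<Sum>i\<in>{i. i < K \<and> \<beta>' i \<noteq> 0}. (\<beta> i - 1 / real s)\<^sup>2) \<le> 5 / (real s * \<rho>)"
  shows "l1_norm K (\<lambda>j. \<beta> j - \<beta>' j) \<le> 5 / sqrt \<rho>"
proof -
  let ?S = "{i. i < K \<and> \<beta>' i \<noteq> 0}" and ?T = "{i. i < K \<and> \<beta> i < \<beta>' i}"
  have simplex: "\<beta>' \<in> prob_simplex K" and card: "card ?S = s"
    and val: "\<And>i. i \<in> ?S \<Longrightarrow> \<beta>' i = 1 / real s"
    using \<beta>' by (auto simp: structured_simplex_def)
  have T: "?T \<subseteq> ?S" using \<beta> by (auto simp: prob_simplex_def)
  have cT: "card ?T \<le> s" using card_mono[OF _ T] card by simp
  have "(\<Sum>i\<in>?T. \<beta>' i - \<beta> i)\<^sup>2 \<le> real (card ?T) * (\<Sum>i\<in>?T. (\<beta>' i - \<beta> i)\<^sup>2)"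
    by (subst mult.commute) (rule sum_squared_le_sum_of_squares)
  also have "\<dots> \<le> real s * (\<Sum>i\<in>?S. (\<beta>' i - \<beta> i)\<^sup>2)"
    using T cT by (intro mult_mono sum_mono2) (auto intro: sum_nonneg)
  also have "(\<Sum>i\<in>?S. (\<beta>' i - \<beta> i)\<^sup>2) = (\<Sum>i\<in>?S. (\<beta> i - 1 / real s)\<^sup>2)"
    using val by (intro sum.cong) (auto simp: power2_commute)
  also have "real s * \<dots> \<le> real s * (5 / (real s * \<rho>))" using Q by (intro mult_left_mono) auto
  also have "\<dots> = 5 / \<rho>" using s by simp
  finally have "(\<Sum>i\<in>?T. \<beta>' i - \<beta> i)\<^sup>2 \<le> 5 / \<rho>" .
  then have "(l1_norm K (\<lambda>j. \<beta> j - \<beta>' j))\<^sup>2 \<le> 4 * (5 / \<rho>)"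
    unfolding l1_norm_diff_eq[OF \<beta> simplex] by (simp add: power_mult_distrib)
  \<comment> \<open>The factor 20 is rounded up to 25 to get the round radius
    \<open>5 / sqrt \<rho>\<close>.\<close>
  also have "\<dots> \<le> (5 / sqrt \<rho>)\<^sup>2" using \<rho> by (simp add: power_divide divide_right_mono)
  finally show ?thesis by (rule power2_le_imp_le) (use \<rho> in simp)
qed

text \<open>The prior is reduced to the component whose spikes sit on the support of
  \<open>\<beta>'\<close>, and the integral to the neighbourhood \<open>?N\<close>. The three
  factors of the bound are the likelihood ratio on \<open>?N\<close>, the weight of the component,
  and the mass at least 1/2 that it gives to \<open>?N\<close>.\<close>

lemma evidence_ge:
  assumes K: "K > 0" and s: "s > 0" and \<theta>: "0 < \<theta>" "\<theta> < 1" and \<rho>: "\<rho>1 > 0" "\<rho>2 > 0"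
    and slab: "(real K * \<rho>2)\<^sup>2 \<le> \<rho>1" and \<beta>': "\<beta>' \<in> structured_simplex s K"
    and t: "t \<ge> 0" and corr: "\<And>j. j < K \<Longrightarrow> \<bar>\<Sum>i<n. X i j * (Y i - mat_vec K X \<beta>' i)\<bar> \<le> t"
  defines "h \<equiv> 5 / sqrt \<rho>1"
  shows "ennreal (exp (- (h * t) - (max_col_norm n K X * h)\<^sup>2 / 2) * (\<theta> ^ s * (1 - \<theta>) ^ (K - s)) / 2
            * std_gaussian_density n (mat_vec K X \<beta>') Y)
      \<le> (\<integral>\<^sup>+\<beta>\<in>prob_simplex K. ennreal (std_gaussian_density n (mat_vec K X \<beta>) Y
                   * double_spike_dirichlet_density K \<theta> \<rho>1 \<rho>2 \<beta>) \<partial>simplex_lborel K)"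
proof -
  let ?S = "{i. i < K \<and> \<beta>' i \<noteq> 0}"
  define \<gamma> :: "nat \<Rightarrow> nat" where "\<gamma> = (\<lambda>i\<in>{..<K}. if \<beta>' i \<noteq> 0 then 1 else 0)"
  define a where "a i = \<rho>1 * real (\<gamma> i) + \<rho>2 * (1 - real (\<gamma> i))" for i
  define w where "w = \<theta> ^ s * (1 - \<theta>) ^ (K - s)"
  define e where "e = exp (- (h * t) - (max_col_norm n K X * h)\<^sup>2 / 2)"
  let ?N = "{\<beta>. (\<Sum>i\<in>?S. (\<beta> i - 1 / real s)\<^sup>2) \<le> 5 / (real s * \<rho>1)}"
  let ?D = "Dirichlet_density K a"
  let ?g = "double_spike_dirichlet_density K \<theta> \<rho>1 \<rho>2"
  let ?p = "\<lambda>\<beta>. std_gaussian_density n (mat_vec K X \<beta>) Y"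
  have card: "card ?S = s" using \<beta>' by (auto simp: structured_simplex_def)
  have \<gamma>: "\<gamma> \<in> {..<K} \<rightarrow>\<^sub>E {0, 1}" by (auto simp: \<gamma>_def)
  have "(\<Sum>i<K. \<gamma> i) = (\<Sum>i<K. if \<beta>' i \<noteq> 0 then 1 else 0)" by (intro sum.cong) (auto simp: \<gamma>_def)
  also have "\<dots> = card {i \<in> {..<K}. \<beta>' i \<noteq> 0}" by (subst sum.If_cases) (auto simp: Int_def)
  also have "\<dots> = s" using card by simp
  finally have sum_\<gamma>: "(\<Sum>i<K. \<gamma> i) = s" .
  have a_pos: "a i > 0" if "i < K" for i using that \<rho> by (auto simp: a_def \<gamma>_def)
  have aS: "a i = \<rho>1" if "i \<in> ?S" for i using that by (auto simp: a_def \<gamma>_def)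
  have sK: "s \<le> K" using card card_mono[of "{..<K}" ?S] by auto
  have "(\<Sum>i<K. a i) = \<rho>1 * real (\<Sum>i<K. \<gamma> i) + \<rho>2 * (real K - real (\<Sum>i<K. \<gamma> i))"
    by (simp add: a_def sum.distrib sum_distrib_left[symmetric] sum_subtractf)
  \<comment> \<open>The parameters off the support add up to at most
    \<open>real K * \<rho>2\<close>, which \<open>slab\<close> bounds by the square root of
    \<open>\<rho>1\<close>, as the concentration lemma requires.\<close>
  then have "(\<Sum>i<K. a i) - real s * \<rho>1 = \<rho>2 * (real K - real s)" by (simp add: sum_\<gamma>)
  also have "(\<rho>2 * (real K - real s))\<^sup>2 \<le> (real K * \<rho>2)\<^sup>2"
    using \<rho> sK by (intro power_mono) (auto simp: mult.commute)
  finally have rest: "((\<Sum>i<K. a i) - real s * \<rho>1)\<^sup>2 \<le> \<rho>1" using slab by simp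
  have D0: "?D \<beta> \<ge> 0" for \<beta> by (rule Dirichlet_density_nonneg[OF K a_pos])
  have w: "w \<ge> 0" using \<theta> by (simp add: w_def)
  have e: "e > 0" by (simp add: e_def)
  have c0: "e * w * ?p \<beta>' \<ge> 0"
    using e w std_gaussian_density_pos[of n "mat_vec K X \<beta>'" Y] by simp
  have [measurable]: "(\<lambda>\<beta>. ennreal (?D \<beta> * indicator ?N \<beta>)) \<in> borel_measurable (simplex_lborel K)"
  proof -
    have [measurable]: "(\<lambda>\<beta>. \<Sum>i\<in>?S. (\<beta> i - 1 / real s)\<^sup>2) \<in> borel_measurable (simplex_lborel K)"
      by measurable
    show ?thesis by measurable
  qed
  have pt: "ennreal (e * w * ?p \<beta>') * ennreal (?D \<beta> * indicator ?N \<beta>)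
      \<le> ennreal (?p \<beta> * ?g \<beta>) * indicator (prob_simplex K) \<beta>" for \<beta>
  proof (cases "\<beta> \<in> prob_simplex K \<and> \<beta> \<in> ?N")
    case True
    have "l1_norm K (\<lambda>j. \<beta> j - \<beta>' j) \<le> h"
      unfolding h_def by (rule structured_l1_le[OF _ \<beta>' s]) (use True \<rho> in auto)
    from std_gaussian_density_mat_vec_ge[OF corr this t K]
    have p: "?p \<beta>' * e \<le> ?p \<beta>" by (simp add: e_def)
    have "w * ?D \<beta> \<le> ?g \<beta>"
      using double_spike_dirichlet_density_ge[OF K \<theta> \<rho> _ \<gamma>, of \<beta>] True
      by (simp add: sum_\<gamma> w_def a_def[abs_def])
    with p have "?p \<beta>' * e * (w * ?D \<beta>) \<le> ?p \<beta> * ?g \<beta>"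
      using w D0 std_gaussian_density_pos[of n "mat_vec K X \<beta>" Y] by (intro mult_mono) auto
    then have "ennreal (?p \<beta>' * e * (w * ?D \<beta>)) \<le> ennreal (?p \<beta> * ?g \<beta>)" by (rule ennreal_leI)
    moreover have "ennreal (e * w * ?p \<beta>') * ennreal (?D \<beta> * indicator ?N \<beta>) = ennreal (?p \<beta>' * e * (w * ?D \<beta>))"
      unfolding ennreal_mult'[OF c0, symmetric] using True by (simp add: mult_ac)
    ultimately show ?thesis using True by simp
  next
    case False
    then have "?D \<beta> * indicator ?N \<beta> = 0" by (auto simp: Dirichlet_density_def)
    then show ?thesis by (simp only: ennreal_0 mult_zero_right zero_le)
  qed
  have "ennreal (e * w / 2 * ?p \<beta>') = ennreal (e * w * ?p \<beta>') * ennreal (1 / 2)"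
    using c0 by (subst ennreal_mult'[symmetric]) auto
  also have "\<dots> \<le> ennreal (e * w * ?p \<beta>') * (\<integral>\<^sup>+\<beta>. ennreal (?D \<beta> * indicator ?N \<beta>) \<partial>simplex_lborel K)"
    by (intro mult_left_mono Dirichlet_concentration K a_pos card s aS rest) auto
  also have "\<dots> = (\<integral>\<^sup>+\<beta>. ennreal (e * w * ?p \<beta>') * ennreal (?D \<beta> * indicator ?N \<beta>) \<partial>simplex_lborel K)"
    by (rule nn_integral_cmult[symmetric]) measurable
  also have "\<dots> \<le> (\<integral>\<^sup>+\<beta>\<in>prob_simplex K. ennreal (?p \<beta> * ?g \<beta>) \<partial>simplex_lborel K)"
    by (intro nn_integral_mono pt)
  finally show ?thesis by (simp add: e_def w_def)
qed

subsection \<open>Posterior contraction\<close>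

text \<open>All exponents are multiples of \<open>E\<close>. The test exponent satisfies
  \<open>\<delta> \<ge> 1600 * E\<close>, giving error exponents of at least \<open>200 * E\<close>
  and \<open>50 * E\<close>, while the evidence costs \<open>25 * E\<close>. Since \<open>E\<close>
  dominates both \<open>real s\<close> and \<open>ln (real K)\<close>, the type I error and the
  quotient of type II error by evidence are each at most \<open>1 / real K\<close>; the noise event
  contributes \<open>2 / real K\<close>.\<close>

lemma expected_posterior_le:
  assumes K: "K \<ge> 3" and s: "s > 0" "2 * s \<le> K" and c: "c > 0"
    and \<theta>: "0 < \<theta>" "\<theta> < 1" "c / real K \<le> \<theta>" "\<theta> \<le> real s / real K"
    and large: "2 - ln c \<le> ln (real K)"
    and \<rho>: "\<rho>1 > 0" "\<rho>2 > 0" and slab: "(real K * \<rho>2)\<^sup>2 \<le> \<rho>1"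
    and \<Phi>: "compat_number n K X s > 0" and M: "M \<ge> 40"
    and \<beta>': "\<beta>' \<in> structured_simplex s K"
  shows "(\<integral>\<^sup>+Y. posterior n K X \<theta> \<rho>1 \<rho>2 Y
              {\<beta> \<in> prob_simplex K.
                 l1_norm K (\<lambda>j. \<beta> j - \<beta>' j)
                 > M / compat_number n K X s
                   * (real s * ln (real K) / min (max_col_norm n K X) (sqrt \<rho>1))}
         \<partial>std_gaussian n (mat_vec K X \<beta>')) \<le> ennreal (4 / real K)"
proof -
  let ?L = "PiM {..<n} (\<lambda>_. lborel :: real measure)"
  define x where "x = max_col_norm n K X"
  define l where "l = ln (real K)"
  define R where "R = min x (sqrt \<rho>1)"
  \<comment> \<open>This is the maximum of 1 and \<open>x / sqrt \<rho>1\<close>. It absorbs the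
    minimum in the radius: the compatibility number times \<open>x * r\<close> equals
    \<open>M * real s * l * W\<close>.\<close>
  define W where "W = x / R"
  define r where "r = M / compat_number n K X s * (real s * l / R)"
  define \<delta> where "\<delta> = (compat_number n K X s * x * r)\<^sup>2 / real s"
  let ?B = "{\<beta> \<in> prob_simplex K. l1_norm K (\<lambda>j. \<beta> j - \<beta>' j) > r}"
  have K0: "K > 0" "K > 1" using K by auto
  have x: "x > 0" unfolding x_def by (rule max_col_norm_pos_if_compat_number_pos[OF K0(1) \<Phi>])
  have R: "R > 0" using x \<rho> by (simp add: R_def)
  \<comment> \<open>Since \<open>exp 1 \<le> 3\<close>, the assumption \<open>K \<ge> 3\<close> is
    what makes the logarithm at least 1.\<close>
  have l: "l \<ge> 1"
  proof -
    have "exp 1 \<le> (3 :: real)" by (rule exp_le)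
    also have "\<dots> \<le> real K" using K by simp
    finally show ?thesis unfolding l_def using K0 by (subst ln_ge_iff) auto
  qed
  have s1: "real s \<ge> 1" using s by simp
  have W1: "W \<ge> 1" unfolding W_def using R by (simp add: R_def)
  have Wx: "x / sqrt \<rho>1 \<le> W" unfolding W_def using R x \<rho> by (intro divide_left_mono) (auto simp: R_def)
  have r0: "r > 0" unfolding r_def using M \<Phi> s1 l R by simp
  have simplex: "\<beta>' \<in> prob_simplex K" and card: "card {i. i < K \<and> \<beta>' i \<noteq> 0} = s"
    using \<beta>' by (auto simp: structured_simplex_def)
  define E where "E = real s * l * W\<^sup>2"
  have WW: "W \<le> W\<^sup>2" "1 \<le> W\<^sup>2" using W1 by (auto simp: power2_eq_square mult_le_cancel_left1 intro: order.trans)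
  have sl: "real s * l \<le> E"
    unfolding E_def using mult_left_mono[OF WW(2), of "real s * l"] s1 l by simp
  have lE: "l \<le> E"
  proof -
    have "1 * l \<le> real s * l" using s1 l by (intro mult_right_mono) auto
    with sl show ?thesis by simp
  qed
  have sE: "real s \<le> E"
  proof -
    have "real s * 1 \<le> real s * l" using s1 l by (intro mult_left_mono) auto
    with sl show ?thesis by simp
  qed
  have WE: "W\<^sup>2 * l \<le> E"
  proof -
    have "1 * (W\<^sup>2 * l) \<le> real s * (W\<^sup>2 * l)" using s1 l by (intro mult_right_mono) auto
    then show ?thesis by (simp add: E_def mult_ac)
  qed

  \<comment> \<open>Here \<open>\<delta>\<close> equals \<open>M\<^sup>2 * (l * E)\<close>, so
    \<open>M \<ge> 40\<close> gives 1600. The choice 40 makes \<open>\<delta> / 32\<close> at least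
    twice the evidence exponent \<open>25 * E\<close>.\<close>
  have \<delta>: "\<delta> \<ge> 1600 * E"
  proof -
    have "compat_number n K X s * x * r = M * real s * l * W"
      using \<Phi> R by (simp add: r_def W_def)
    then have "\<delta> = M\<^sup>2 * (l * E)"
      unfolding \<delta>_def E_def using s1 by (simp add: power2_eq_square)
    also have "\<dots> \<ge> 40\<^sup>2 * (1 * E)"
      using M l lE by (intro mult_mono power_mono) auto
    finally show ?thesis by simp
  qed
  obtain F where F: "F \<in> sets ?L"
    "emeasure (std_gaussian n (mat_vec K X \<beta>')) F \<le> ennreal (2 ^ s * exp (- \<delta> / 8))"
    "\<And>\<beta>. \<beta> \<in> ?B \<Longrightarrow> emeasure (std_gaussian n (mat_vec K X \<beta>)) (space ?L - F) \<le> ennreal (exp (- \<delta> / 32))"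
    by (rule l1_complement_test[OF simplex \<Phi> K0(1) s(1) r0 \<delta>_def[unfolded x_def]]) (auto simp: card)
  define t where "t = 2 * x * sqrt l"
  define G where "G = {y \<in> space ?L. \<forall>j\<in>{..<K}. \<bar>\<Sum>i<n. X i j * (y i - mat_vec K X \<beta>' i)\<bar> \<le> t}"
  have G: "G \<in> sets ?L" "emeasure (std_gaussian n (mat_vec K X \<beta>')) (space ?L - G) \<le> ennreal (2 / real K)"
    unfolding G_def t_def x_def l_def
    using noise_correlation_event[OF x[unfolded x_def] K0(2)] by blast+
  have t: "t \<ge> 0" using x l by (simp add: t_def)
  \<comment> \<open>The 25 splits as 10 for the noise term \<open>5 / sqrt \<rho>1 * t\<close>, 13
    for the quadratic term (25/2 rounded up) and 2 for the prior weight. The final 1/2 is the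
    Dirichlet mass near the truth.\<close>
  define d where "d = exp (- 25 * E) / 2"
  have d_le: "d \<le> exp (- (5 / sqrt \<rho>1 * t) - (x * (5 / sqrt \<rho>1))\<^sup>2 / 2) * (\<theta> ^ s * (1 - \<theta>) ^ (K - s)) / 2"
  proof -
    have "x / sqrt \<rho>1 * sqrt l \<le> W * l"
      using Wx W1 l x \<rho> by (intro mult_mono) (auto intro: real_le_lsqrt simp: power2_eq_square mult_le_cancel_left1)
    also have "\<dots> \<le> W\<^sup>2 * l" using WW l by (intro mult_right_mono) auto
    also have "\<dots> \<le> E" by (rule WE)
    finally have 1: "5 / sqrt \<rho>1 * t \<le> 10 * E" by (simp add: t_def)
    have "(x / sqrt \<rho>1)\<^sup>2 \<le> W\<^sup>2" using Wx x \<rho> by (intro power_mono) auto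
    also have "\<dots> \<le> W\<^sup>2 * l" using l WW by (simp add: mult_le_cancel_left1)
    also have "\<dots> \<le> E" by (rule WE)
    finally have 2: "(x * (5 / sqrt \<rho>1))\<^sup>2 / 2 \<le> 13 * E"
      using lE l by (simp add: power_mult_distrib power_divide)
    have "exp (- 23 * E) * exp (- 2 * E)
        \<le> exp (- (5 / sqrt \<rho>1 * t) - (x * (5 / sqrt \<rho>1))\<^sup>2 / 2) * (\<theta> ^ s * (1 - \<theta>) ^ (K - s))"
    proof (rule mult_mono)
      have "exp (- 2 * E) \<le> exp (- 2 * real s * ln (real K))"
        using sl by (simp add: l_def)
      also have "\<dots> \<le> \<theta> ^ s * (1 - \<theta>) ^ (K - s)"
        by (rule spike_weight_ge[OF K0(1) s c \<theta>(3,4) large])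
      finally show "exp (- 2 * E) \<le> \<theta> ^ s * (1 - \<theta>) ^ (K - s)" .
    qed (use 1 2 in auto)
    then show ?thesis by (simp add: d_def mult_exp_exp)
  qed
  have "(\<integral>\<^sup>+Y. posterior n K X \<theta> \<rho>1 \<rho>2 Y ?B \<partial>std_gaussian n (mat_vec K X \<beta>'))
      \<le> emeasure (std_gaussian n (mat_vec K X \<beta>')) F
        + emeasure (std_gaussian n (mat_vec K X \<beta>')) (space ?L - G) + ennreal (exp (- \<delta> / 32) / d)"
  proof (rule nn_integral_posterior_le)
    have "{\<beta> \<in> space (PiM {..<K} (\<lambda>_. lborel :: real measure)). l1_norm K (\<lambda>j. \<beta> j - \<beta>' j) > r}
        \<in> sets (simplex_lborel K)"
      unfolding l1_norm_def sets_simplex_lborel by measurable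
    with prob_simplex_measurable[of K]
    have "prob_simplex K \<inter> {\<beta> \<in> space (PiM {..<K} (\<lambda>_. lborel :: real measure)). l1_norm K (\<lambda>j. \<beta> j - \<beta>' j) > r}
        \<in> sets (simplex_lborel K)" by (rule sets.Int)
    also have "prob_simplex K \<inter> {\<beta> \<in> space (PiM {..<K} (\<lambda>_. lborel :: real measure)). l1_norm K (\<lambda>j. \<beta> j - \<beta>' j) > r} = ?B"
      by (auto simp: prob_simplex_def space_PiM)
    finally show "?B \<in> sets (simplex_lborel K)" .
  next
    fix Y assume "Y \<in> G"
    then have corr: "\<bar>\<Sum>i<n. X i j * (Y i - mat_vec K X \<beta>' i)\<bar> \<le> t" if "j < K" for j
      using that by (auto simp: G_def)
    have "ennreal (d * std_gaussian_density n (mat_vec K X \<beta>') Y)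
        \<le> ennreal (exp (- (5 / sqrt \<rho>1 * t) - (x * (5 / sqrt \<rho>1))\<^sup>2 / 2) * (\<theta> ^ s * (1 - \<theta>) ^ (K - s)) / 2
            * std_gaussian_density n (mat_vec K X \<beta>') Y)"
      by (intro ennreal_leI mult_right_mono d_le less_imp_le[OF std_gaussian_density_pos])
    also have "\<dots> \<le> (\<integral>\<^sup>+\<beta>\<in>prob_simplex K. ennreal (std_gaussian_density n (mat_vec K X \<beta>) Y
                   * double_spike_dirichlet_density K \<theta> \<rho>1 \<rho>2 \<beta>) \<partial>simplex_lborel K)"
      unfolding x_def by (rule evidence_ge[OF K0(1) s(1) \<theta>(1,2) \<rho> slab \<beta>' t corr])
    finally show "ennreal (d * std_gaussian_density n (mat_vec K X \<beta>') Y)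
      \<le> (\<integral>\<^sup>+\<beta>\<in>prob_simplex K. ennreal (std_gaussian_density n (mat_vec K X \<beta>) Y
                   * double_spike_dirichlet_density K \<theta> \<rho>1 \<rho>2 \<beta>) \<partial>simplex_lborel K)" .
  qed (use K0 \<theta> \<rho> F G in \<open>auto simp: d_def\<close>)
  also have "\<dots> \<le> ennreal (2 ^ s * exp (- \<delta> / 8)) + ennreal (2 / real K) + ennreal (exp (- \<delta> / 32) / d)"
    by (intro add_mono F G order.refl)
  also have "\<dots> = ennreal (2 ^ s * exp (- \<delta> / 8) + 2 / real K + exp (- \<delta> / 32) / d)"
    by (simp add: d_def)
  also have "\<dots> \<le> ennreal (4 / real K)"
  proof (rule ennreal_leI)
    have exp_l: "exp (- l) = 1 / real K" using K0 by (simp add: l_def exp_minus inverse_eq_divide)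
    have "(2 :: real) ^ s \<le> exp 1 ^ s" using exp_ge_add_one_self[of 1] by (intro power_mono) auto
    also have "\<dots> = exp (real s)" by (simp add: exp_of_nat_mult[symmetric])
    finally have "2 ^ s * exp (- \<delta> / 8) \<le> exp (real s) * exp (- \<delta> / 8)" by (intro mult_right_mono) auto
    also have "\<dots> \<le> exp (- l)" using \<delta> sE lE l by (simp add: mult_exp_exp)
    finally have 1: "2 ^ s * exp (- \<delta> / 8) \<le> 1 / real K" by (simp only: exp_l)
    have "exp (- \<delta> / 32) / d = 2 * exp (- \<delta> / 32 + 25 * E)"
      unfolding exp_add d_def by (simp add: exp_minus inverse_eq_divide)
    \<comment> \<open>The leading factor 2 is absorbed as \<open>exp 1\<close>, and the exponent
      \<open>- 25 * E\<close> has room for it because \<open>E\<close> is at least 1.\<close>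
    also have "\<dots> \<le> exp 1 * exp (- 25 * E)"
      using \<delta> exp_ge_add_one_self[of 1] by (intro mult_mono) auto
    also have "\<dots> \<le> exp (- l)" using lE l by (simp add: mult_exp_exp)
    finally have 2: "exp (- \<delta> / 32) / d \<le> 1 / real K" by (simp only: exp_l)
    show "2 ^ s * exp (- \<delta> / 8) + 2 / real K + exp (- \<delta> / 32) / d \<le> 4 / real K"
      using 1 2 by simp
  qed
  finally show ?thesis by (simp only: r_def R_def x_def l_def)
qed

theorem theorem1:
  fixes n s :: "nat \<Rightarrow> nat"
    and X :: "nat \<Rightarrow> nat \<Rightarrow> nat \<Rightarrow> real"
    and \<theta> :: "nat \<Rightarrow> real"
    and \<alpha>1 \<alpha>2 c :: real
  assumes "\<alpha>1 > 0" and "\<alpha>2 > 0" and "\<alpha>1 / 2 + \<alpha>2 \<ge> 1"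
    and "\<forall>\<^sub>F K in sequentially. 0 < s K"
    and "(\<lambda>K. real (s K)) \<in> o(\<lambda>K. real K)"
    and "c > 0"
    and "\<forall>\<^sub>F K in sequentially.
           0 < \<theta> K \<and> \<theta> K < 1 \<and> c / real K \<le> \<theta> K \<and> \<theta> K \<le> real (s K) / real K"
    and "\<forall>\<^sub>F K in sequentially. compat_number (n K) K (X K) (s K) > 0"
  shows "\<exists>M0>0. \<forall>M\<ge>M0.
    (\<lambda>K. \<Squnion>\<beta>'\<in>structured_simplex (s K) K.
       \<integral>\<^sup>+Y. posterior (n K) K (X K) (\<theta> K) (real K powr \<alpha>1) (real K powr - \<alpha>2) Y
              {\<beta> \<in> prob_simplex K.
                 l1_norm K (\<lambda>j. \<beta> j - \<beta>' j)
                 > M / compat_number (n K) K (X K) (s K)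
                   * (real (s K) * ln (real K)
                      / min (max_col_norm (n K) K (X K)) (sqrt (real K powr \<alpha>1)))}
         \<partial>std_gaussian (n K) (mat_vec K (X K) \<beta>')) \<longlonglongrightarrow> 0"
\<comment> \<open>The threshold for \<open>M\<close> is the absolute constant of the
  finite-\<open>K\<close> bound, the same for all \<open>\<alpha>1\<close>, \<open>\<alpha>2\<close>
  and \<open>c\<close>.\<close>
proof (intro exI[of _ 40] conjI allI impI)
  fix M :: real assume M: "M \<ge> 40"
  let ?f = "\<lambda>K. \<Squnion>\<beta>'\<in>structured_simplex (s K) K.
       \<integral>\<^sup>+Y. posterior (n K) K (X K) (\<theta> K) (real K powr \<alpha>1) (real K powr - \<alpha>2) Y
              {\<beta> \<in> prob_simplex K.
                 l1_norm K (\<lambda>j. \<beta> j - \<beta>' j)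
                 > M / compat_number (n K) K (X K) (s K)
                   * (real (s K) * ln (real K)
                      / min (max_col_norm (n K) K (X K)) (sqrt (real K powr \<alpha>1)))}
         \<partial>std_gaussian (n K) (mat_vec K (X K) \<beta>')"
  \<comment> \<open>From the growth condition on \<open>s\<close> the proof takes that
    \<open>2 * s K \<le> K\<close> eventually, which keeps \<open>\<theta> K\<close> at most
    1/2.\<close>
  have half: "\<forall>\<^sub>F K in sequentially. norm (real (s K)) \<le> 1 / 2 * norm (real K)"
    using assms(5) by (rule landau_o.smallD) simp
  have large: "\<forall>\<^sub>F K in sequentially. 2 - ln c \<le> ln (real K)"
    using filterlim_compose[OF ln_at_top filterlim_real_sequentially] by (simp add: filterlim_at_top)
  have "\<forall>\<^sub>F K in sequentially. ?f K \<le> ennreal (4 / real K)"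
    using assms(4,7,8) half large eventually_ge_at_top[of 3]
  proof eventually_elim
    case (elim K)
    have K: "real K \<ge> 1" using elim by simp
    \<comment> \<open>The condition \<open>\<alpha>1 / 2 + \<alpha>2 \<ge> 1\<close> enters here, in
      the form \<open>2 * (1 - \<alpha>2) \<le> \<alpha>1\<close>.\<close>
    have slab: "(real K * real K powr - \<alpha>2)\<^sup>2 \<le> real K powr \<alpha>1"
    proof -
      have "(real K * real K powr - \<alpha>2)\<^sup>2 = (real K powr (1 - \<alpha>2))\<^sup>2"
        using K by (simp add: powr_diff powr_minus divide_inverse)
      also have "\<dots> = real K powr (2 * (1 - \<alpha>2))"
        using K by (simp add: powr_power mult.commute)
      also have "\<dots> \<le> real K powr \<alpha>1"
        using K assms(3) by (intro powr_mono) auto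
      finally show ?thesis .
    qed
    show ?case
    proof (rule SUP_least)
      fix \<beta>' assume "\<beta>' \<in> structured_simplex (s K) K"
      then show "(\<integral>\<^sup>+Y. posterior (n K) K (X K) (\<theta> K) (real K powr \<alpha>1) (real K powr - \<alpha>2) Y
              {\<beta> \<in> prob_simplex K.
                 l1_norm K (\<lambda>j. \<beta> j - \<beta>' j)
                 > M / compat_number (n K) K (X K) (s K)
                   * (real (s K) * ln (real K)
                      / min (max_col_norm (n K) K (X K)) (sqrt (real K powr \<alpha>1)))}
         \<partial>std_gaussian (n K) (mat_vec K (X K) \<beta>')) \<le> ennreal (4 / real K)"
        using elim M slab assms(6) by (intro expected_posterior_le[where c = c]) auto
    qed
  qed
  moreover have "(\<lambda>K. ennreal (4 / real K)) \<longlonglongrightarrow> ennreal 0"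
    by (intro tendsto_ennrealI lim_const_over_n)
  ultimately show "?f \<longlonglongrightarrow> 0"
    by (intro tendsto_sandwich[of "\<lambda>_. 0" ?f sequentially "\<lambda>K. ennreal (4 / real K)" 0]) auto
qed simp

end
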